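(* Let $p,q\ge 2$ be any two integers and let $f\in L^\infty(\mathbb{T})$. Then the operators $\Gamma_q[f]$ on $\ell^2(T_q)$ and $\Gamma_p[f]$ on $\ell^2(T_p)$ are unitarily equivalent.
   Context: For an integer $q\ge 2$, $T_q$ denotes the (vertex set of the) infinite rooted $q$-homogeneous tree: there is a root $o$, and each vertex has exactly $q$ children. $d$ is the graph distance and $|\sigma| := d(o,\sigma)$. Write $\sigma_1\preccurlyeq\sigma_2$ if $\sigma_1,\sigma_2$ lie on a common geodesic ray starting at the root and $|\sigma_1|\le|\sigma_2|$. Let $\mathcal{C}\subset T_q\times T_q$ be the set of comparable pairs ($\sigma_1\preccurlyeq\sigma_2$ or $\sigma_2\preccurlyeq\sigma_1$), with indicator function $\mathbf{1}_{\mathcal{C}}$. $\mathbb{T}=\mathbb{R}/2\pi\mathbb{Z}$. For $f\in L^\infty(\mathbb{T})$, $\widehat f(n)=\int_{\mathbb{T}} f(e^{i\theta})e^{-in\theta}\frac{d\theta}{2\pi}$, and $$\Gamma_q[f](\sigma_1,\sigma_2) := q^{-d(\sigma_1,\sigma_2)/2}\,\widehat f(|\sigma_1|-|\sigma_2|)\,\mathbf{1}_{\mathcal{C}}(\sigma_1,\sigma_2).$$ Bounded operators $A$ on $\ell^2(T_q)$ are identified with their kernels $A(\sigma_1,\sigma_2)=\langle A\delta_{\sigma_2},\delta_{\sigma_1}\rangle$; for every $f\in L^\infty(\mathbb{T})$ the kernel $\Gamma_q[f]$ represents a bounded operator on $\ell^2(T_q)$. *)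

theory Defs
  imports "HOL-Analysis.Analysis"
begin

section \<open>The Hilbert space of square summable functions on a set\<close>

text \<open>Elements of the space over \<open>V\<close> are total functions vanishing outside \<open>V\<close>, so that equality
  of elements is equality of functions.  Operators are total functions of which only the values on
  the space matter.\<close>

definition ell2 :: "'a set \<Rightarrow> ('a \<Rightarrow> complex) set" where
  "ell2 V = {x. (\<forall>v. v \<notin> V \<longrightarrow> x v = 0) \<and> (\<lambda>v. (norm (x v))\<^sup>2) summable_on V}"

definition ell2_inner :: "'a set \<Rightarrow> ('a \<Rightarrow> complex) \<Rightarrow> ('a \<Rightarrow> complex) \<Rightarrow> complex" where
  "ell2_inner V x y = (\<Sum>\<^sub>\<infinity>v\<in>V. x v * cnj (y v))"

definition ell2_norm :: "'a set \<Rightarrow> ('a \<Rightarrow> complex) \<Rightarrow> real" where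
  "ell2_norm V x = sqrt (\<Sum>\<^sub>\<infinity>v\<in>V. (norm (x v))\<^sup>2)"

definition ell2_delta :: "'a \<Rightarrow> 'a \<Rightarrow> complex" where
  "ell2_delta w = (\<lambda>v. if v = w then 1 else 0)"

definition ell2_linear ::
    "'a set \<Rightarrow> 'b set \<Rightarrow> (('a \<Rightarrow> complex) \<Rightarrow> ('b \<Rightarrow> complex)) \<Rightarrow> bool" where
  "ell2_linear V W A \<longleftrightarrow>
     (\<forall>x\<in>ell2 V. A x \<in> ell2 W) \<and>
     (\<forall>x\<in>ell2 V. \<forall>y\<in>ell2 V. A (\<lambda>v. x v + y v) = (\<lambda>w. A x w + A y w)) \<and>
     (\<forall>c. \<forall>x\<in>ell2 V. A (\<lambda>v. c * x v) = (\<lambda>w. c * A x w))"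

definition ell2_bounded_operator ::
    "'a set \<Rightarrow> (('a \<Rightarrow> complex) \<Rightarrow> ('a \<Rightarrow> complex)) \<Rightarrow> bool" where
  "ell2_bounded_operator V A \<longleftrightarrow>
     ell2_linear V V A \<and> (\<exists>C. \<forall>x\<in>ell2 V. ell2_norm V (A x) \<le> C * ell2_norm V x)"

definition ell2_unitary ::
    "'a set \<Rightarrow> 'b set \<Rightarrow> (('a \<Rightarrow> complex) \<Rightarrow> ('b \<Rightarrow> complex)) \<Rightarrow> bool" where
  "ell2_unitary V W U \<longleftrightarrow>
     ell2_linear V W U \<and> bij_betw U (ell2 V) (ell2 W) \<and>
     (\<forall>x\<in>ell2 V. \<forall>y\<in>ell2 V. ell2_inner W (U x) (U y) = ell2_inner V x y)"

text \<open>Unitary equivalence is a relation between bounded operators; boundedness is part of it.\<close>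

definition unitarily_equivalent ::
    "'a set \<Rightarrow> (('a \<Rightarrow> complex) \<Rightarrow> ('a \<Rightarrow> complex)) \<Rightarrow>
     'b set \<Rightarrow> (('b \<Rightarrow> complex) \<Rightarrow> ('b \<Rightarrow> complex)) \<Rightarrow> bool" where
  "unitarily_equivalent V A W B \<longleftrightarrow>
     ell2_bounded_operator V A \<and> ell2_bounded_operator W B \<and>
     (\<exists>U. ell2_unitary V W U \<and> (\<forall>x\<in>ell2 V. U (A x) = B (U x)))"

text \<open>The operator with a given kernel.  The lemmas \<open>kernel_operator_kernel\<close> and
  \<open>kernel_operator_unique\<close> below show that this is the usual identification: a bounded operator
  \<open>A\<close> has kernel \<open>K v w = \<langle>A \<delta>\<^sub>w, \<delta>\<^sub>v\<rangle>\<close> iff it agrees with \<open>kernel_operator V K\<close>.\<close>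

definition kernel_operator ::
    "'a set \<Rightarrow> ('a \<Rightarrow> 'a \<Rightarrow> complex) \<Rightarrow> ('a \<Rightarrow> complex) \<Rightarrow> ('a \<Rightarrow> complex)" where
  "kernel_operator V K x = (\<lambda>v. if v \<in> V then \<Sum>\<^sub>\<infinity>w\<in>V. K v w * x w else 0)"

lemma infsum_single_point:
  fixes g :: "'a \<Rightarrow> 'b::{comm_monoid_add,t2_space}"
  assumes "v \<in> V" "\<And>w. w \<in> V \<Longrightarrow> w \<noteq> v \<Longrightarrow> g w = 0"
  shows "infsum g V = g v"
proof -
  have "infsum g V = infsum g {v}"
    by (rule infsum_cong_neutral) (use assms in auto)
  then show ?thesis by simp
qed

lemma ell2_inner_delta:
  assumes "v \<in> V"
  shows "ell2_inner V x (ell2_delta v) = x v"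
  unfolding ell2_inner_def
  by (subst infsum_single_point[OF assms]) (auto simp: ell2_delta_def)

lemma kernel_operator_kernel:
  assumes "v \<in> V" "w \<in> V"
  shows "ell2_inner V (kernel_operator V K (ell2_delta w)) (ell2_delta v) = K v w"
proof -
  have "(\<Sum>\<^sub>\<infinity>u\<in>V. K v u * ell2_delta w u) = K v w"
    by (subst infsum_single_point[OF assms(2)]) (auto simp: ell2_delta_def)
  then show ?thesis
    using assms by (simp add: ell2_inner_delta kernel_operator_def)
qed

lemma ell2_norm_ge_point:
  assumes "x \<in> ell2 V" "v \<in> V"
  shows "norm (x v) \<le> ell2_norm V x"
proof -
  have "infsum (\<lambda>v. (norm (x v))\<^sup>2) {v} \<le> infsum (\<lambda>v. (norm (x v))\<^sup>2) V"
    by (rule infsum_mono_neutral) (use assms in \<open>auto simp: ell2_def\<close>)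
  then show ?thesis
    by (simp add: ell2_norm_def real_le_rsqrt)
qed

lemma ell2_finite:
  assumes "finite F" "F \<subseteq> V"
  shows "(\<lambda>v. if v \<in> F then x v else 0) \<in> ell2 V"
proof -
  have "(\<lambda>v. (norm (if v \<in> F then x v else 0))\<^sup>2) summable_on V \<longleftrightarrow>
        (\<lambda>v. (norm (x v))\<^sup>2) summable_on F"
    by (rule summable_on_cong_neutral) (use assms in auto)
  then show ?thesis using assms by (auto simp: ell2_def)
qed

lemma
  assumes "ell2_linear V W A"
  shows ell2_linear_add: "\<And>x y. x \<in> ell2 V \<Longrightarrow> y \<in> ell2 V \<Longrightarrow> A (\<lambda>v. x v + y v) = (\<lambda>w. A x w + A y w)"
    and ell2_linear_scale: "\<And>c x. x \<in> ell2 V \<Longrightarrow> A (\<lambda>v. c * x v) = (\<lambda>w. c * A x w)"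
  using assms unfolding ell2_linear_def by blast+

lemma ell2_linear_finite:
  assumes A: "ell2_linear V W A" and "finite F" "F \<subseteq> V"
  shows "A (\<lambda>v. if v \<in> F then x v else 0) = (\<lambda>u. \<Sum>w\<in>F. x w * A (ell2_delta w) u)"
  using assms(2,3)
proof (induction F rule: finite_induct)
  case empty
  have z: "(\<lambda>v. 0) \<in> ell2 V" by (simp add: ell2_def)
  show ?case using ell2_linear_scale[OF A z, of 0] by simp
next
  case (insert a F)
  have d: "ell2_delta a \<in> ell2 V"
    using ell2_finite[of "{a}" V "\<lambda>_. 1"] insert.prems by (simp add: ell2_delta_def)
  have "(\<lambda>v. x a * ell2_delta a v) = (\<lambda>v. if v \<in> {a} then x v else 0)"
    by (rule ext) (simp add: ell2_delta_def)
  then have e: "(\<lambda>v. x a * ell2_delta a v) \<in> ell2 V"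
    using ell2_finite[of "{a}" V x] insert.prems by simp
  have f: "(\<lambda>v. if v \<in> F then x v else 0) \<in> ell2 V"
    using ell2_finite insert by auto
  have "(\<lambda>v. if v \<in> insert a F then x v else 0)
        = (\<lambda>v. x a * ell2_delta a v + (if v \<in> F then x v else 0))"
    by (rule ext) (use insert.hyps in \<open>auto simp: ell2_delta_def\<close>)
  then have "A (\<lambda>v. if v \<in> insert a F then x v else 0)
        = (\<lambda>w. A (\<lambda>v. x a * ell2_delta a v) w + A (\<lambda>v. if v \<in> F then x v else 0) w)"
    by (simp only: ell2_linear_add[OF A e f])
  then show ?case
    using insert.prems
    by (simp only: ell2_linear_scale[OF A d] insert.IH insert_subset sum.insert[OF insert.hyps])
qed

lemma kernel_operator_unique:
  assumes A: "ell2_bounded_operator V A"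
    and K: "\<And>v w. v \<in> V \<Longrightarrow> w \<in> V \<Longrightarrow> ell2_inner V (A (ell2_delta w)) (ell2_delta v) = K v w"
    and x: "x \<in> ell2 V"
  shows "A x = kernel_operator V K x"
proof
  fix v
  have lin: "ell2_linear V V A" using A by (simp add: ell2_bounded_operator_def)
  obtain C where C: "\<And>x. x \<in> ell2 V \<Longrightarrow> ell2_norm V (A x) \<le> C * ell2_norm V x"
    using A unfolding ell2_bounded_operator_def by blast
  have Ax: "A y \<in> ell2 V" if "y \<in> ell2 V" for y
    using lin that unfolding ell2_linear_def by blast
  show "A x v = kernel_operator V K x v"
  proof (cases "v \<in> V")
    case False
    then show ?thesis using Ax[OF x] by (simp add: kernel_operator_def ell2_def)
  next
    case True
    define s where "s = (\<lambda>w. (norm (x w))\<^sup>2)"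
    have s: "s summable_on V" using x by (simp add: ell2_def s_def)
    have bound: "norm ((\<Sum>w\<in>F. K v w * x w) - A x v) \<le> \<bar>C\<bar> * sqrt (infsum s V - sum s F)"
      if F: "finite F" "F \<subseteq> V" for F
    proof -
      define y where "y = (\<lambda>w. if w \<in> F then x w else 0)"
      define z where "z = (\<lambda>w. if w \<in> V - F then x w else 0)"
      have y: "y \<in> ell2 V" unfolding y_def by (rule ell2_finite[OF F])
      have "(\<lambda>w. (norm (z w))\<^sup>2) summable_on V \<longleftrightarrow> s summable_on (V - F)"
        by (rule summable_on_cong_neutral) (auto simp: z_def s_def)
      moreover have "s summable_on (V - F)"
        using s by (rule summable_on_subset_banach) auto
      ultimately have z: "z \<in> ell2 V" by (auto simp: ell2_def z_def)
      have "(\<Sum>\<^sub>\<infinity>w\<in>V. (norm (z w))\<^sup>2) = infsum s (V - F)"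
        by (rule infsum_cong_neutral) (auto simp: z_def s_def)
      also have "\<dots> = infsum s V - sum s F"
        using infsum_Diff[OF s, of F] F by simp
      finally have nz: "ell2_norm V z = sqrt (infsum s V - sum s F)" by (simp add: ell2_norm_def)
      have "x = (\<lambda>w. y w + z w)" 
        by (rule ext) (use x F in \<open>auto simp: y_def z_def ell2_def\<close>)
      then have "A x = (\<lambda>w. A y w + A z w)"
        using ell2_linear_add[OF lin y z] by simp
      moreover have "A y v = (\<Sum>w\<in>F. K v w * x w)"
      proof -
        have "A y v = (\<Sum>w\<in>F. x w * A (ell2_delta w) v)"
          unfolding y_def by (simp add: ell2_linear_finite[OF lin F])
        also have "\<dots> = (\<Sum>w\<in>F. K v w * x w)"
          using K True F by (intro sum.cong) (auto simp: ell2_inner_delta)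
        finally show ?thesis .
      qed
      ultimately have "norm ((\<Sum>w\<in>F. K v w * x w) - A x v) = norm (A z v)" by simp
      also have "\<dots> \<le> ell2_norm V (A z)" by (rule ell2_norm_ge_point[OF Ax[OF z] True])
      also have "\<dots> \<le> C * ell2_norm V z" by (rule C[OF z])
      also have "\<dots> \<le> \<bar>C\<bar> * ell2_norm V z"
        by (rule mult_right_mono) (auto simp: ell2_norm_def infsum_nonneg)
      finally show ?thesis by (simp add: nz)
    qed
    have "(sum s \<longlongrightarrow> infsum s V) (finite_subsets_at_top V)"
      using s has_sum_def has_sum_infsum by blast
    then have "((\<lambda>F. \<bar>C\<bar> * sqrt (infsum s V - sum s F)) \<longlongrightarrow> \<bar>C\<bar> * sqrt (infsum s V - infsum s V))
                 (finite_subsets_at_top V)"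
      by (intro tendsto_intros)
    then have "((\<lambda>F. \<bar>C\<bar> * sqrt (infsum s V - sum s F)) \<longlongrightarrow> 0) (finite_subsets_at_top V)"
      by simp
    then have "((\<lambda>F. (\<Sum>w\<in>F. K v w * x w) - A x v) \<longlongrightarrow> 0) (finite_subsets_at_top V)"
      by (rule Lim_null_comparison[rotated])
         (auto intro!: eventually_finite_subsets_at_top_weakI bound)
    then have "((\<lambda>w. K v w * x w) has_sum A x v) V"
      unfolding has_sum_def using Lim_null by blast
    then show ?thesis using True by (simp add: kernel_operator_def infsumI)
  qed
qed

section \<open>The rooted homogeneous tree\<close>

text \<open>A vertex is the list of child indices along the path from the root.\<close>

definition tree :: "nat \<Rightarrow> nat list set" where
  "tree q = lists {..<q}"

abbreviation tree_root :: "nat list" where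
  "tree_root \<equiv> []"

definition tree_edges :: "nat \<Rightarrow> (nat list \<times> nat list) set" where
  "tree_edges q = {(s, t). s \<in> tree q \<and> t \<in> tree q \<and> (\<exists>i. t = s @ [i] \<or> s = t @ [i])}"

definition tree_dist :: "nat \<Rightarrow> nat list \<Rightarrow> nat list \<Rightarrow> nat" where
  "tree_dist q s t = (LEAST n. (s, t) \<in> tree_edges q ^^ n)"

definition tree_level :: "nat \<Rightarrow> nat list \<Rightarrow> nat" where
  "tree_level q s = tree_dist q tree_root s"

definition root_ray :: "nat \<Rightarrow> (nat \<Rightarrow> nat list) \<Rightarrow> bool" where
  "root_ray q r \<longleftrightarrow>
     r 0 = tree_root \<and> range r \<subseteq> tree q \<and>
     (\<forall>m n. int (tree_dist q (r m) (r n)) = \<bar>int m - int n\<bar>)"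

definition tree_le :: "nat \<Rightarrow> nat list \<Rightarrow> nat list \<Rightarrow> bool" where
  "tree_le q s t \<longleftrightarrow>
     (\<exists>r. root_ray q r \<and> s \<in> range r \<and> t \<in> range r) \<and> tree_level q s \<le> tree_level q t"

definition comparable_pairs :: "nat \<Rightarrow> (nat list \<times> nat list) set" where
  "comparable_pairs q = {(s, t). s \<in> tree q \<and> t \<in> tree q \<and> (tree_le q s t \<or> tree_le q t s)}"

section \<open>Bounded functions on the circle and the associated operators\<close>

text \<open>A function on the circle is given by its values on the unit circle of the complex plane;
  a class in \<open>L\<^sup>\<infinity>\<close> is given by any representative.\<close>

definition Linf_circle :: "(complex \<Rightarrow> complex) set" where
  "Linf_circle = {f. (\<lambda>\<theta>. f (cis \<theta>)) \<in> borel_measurable lebesgue \<and>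
                     (\<exists>C. AE \<theta> in lebesgue. norm (f (cis \<theta>)) \<le> C)}"

definition fourier_coeff :: "(complex \<Rightarrow> complex) \<Rightarrow> int \<Rightarrow> complex" where
  "fourier_coeff f n =
     (LINT \<theta>:{0..2 * pi}|lebesgue. f (cis \<theta>) * cis (- (of_int n * \<theta>))) / of_real (2 * pi)"

definition Gamma_kernel :: "nat \<Rightarrow> (complex \<Rightarrow> complex) \<Rightarrow> nat list \<Rightarrow> nat list \<Rightarrow> complex" where
  "Gamma_kernel q f s t =
     of_real (real q powr (- real (tree_dist q s t) / 2)) *
     fourier_coeff f (int (tree_level q s) - int (tree_level q t)) *
     indicator (comparable_pairs q) (s, t)"

definition Gamma_operator ::
    "nat \<Rightarrow> (complex \<Rightarrow> complex) \<Rightarrow> (nat list \<Rightarrow> complex) \<Rightarrow> (nat list \<Rightarrow> complex)" where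
  "Gamma_operator q f = kernel_operator (tree q) (Gamma_kernel q f)"

end

theory Submission
  imports Defs "HOL-Library.Sublist"
begin

text \<open>
  Let \<open>S\<close> be the isometry of the space over the tree that spreads the value at a vertex evenly over
  its \<open>q\<close> children, each child receiving the factor \<open>q\<^sup>-\<^sup>1\<^sup>/\<^sup>2\<close>.  The kernel of \<open>S\<^sup>n\<close> is
  \<open>q\<^sup>-\<^sup>n\<^sup>/\<^sup>2\<close> on the pairs (descendant, ancestor) at distance \<open>n\<close>, so the operator attached to \<open>f\<close> is
  the Toeplitz operator of \<open>f\<close> built on \<open>S\<close> in place of the unilateral shift.  The isometry \<open>S\<close> is
  pure with a defect space of countably infinite dimension.  Its Wold decomposition therefore does not
  depend on \<open>q\<close>: every such operator is unitarily equivalent to the direct sum of countably many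
  copies of the Toeplitz matrix with entries \<open>fourier_coeff f (m - n)\<close>.

  The Wold decomposition can be made explicit.  The vertices of level \<open>m\<close> are the words of length \<open>m\<close>
  over \<open>{0, ..., q - 1}\<close>, that is, the elements of the group \<open>(\<int>/q)\<^sup>m\<close>, and the characters of these
  groups form an orthonormal basis, again indexed by words.  Spreading evenly over the children appends
  the frequency \<open>0\<close> to a character, so in this basis \<open>S\<close> maps the word \<open>k\<close> to \<open>k @ [0]\<close>.  Two words
  are in the same orbit of \<open>S\<close> iff they have the same \<^emph>\<open>stem\<close>, the word without its trailing zeros,
  and the Fourier transform turns the kernel for \<open>f\<close> into the matrix with entry
  \<open>fourier_coeff f (length k - length k')\<close> for \<open>k\<close>, \<open>k'\<close> with equal stems and \<open>0\<close> otherwise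
  (\<open>Gamma_kernel_fourier\<close>).  There are countably infinitely many stems for every \<open>q \<ge> 2\<close>, so a bijection
  between the stems for \<open>p\<close> and for \<open>q\<close> identifies the two matrices (\<open>tree_toeplitz_equivalent\<close>).

  Boundedness is proved for the direct sum of Toeplitz matrices (\<open>toeplitz_sum_bounded\<close>) and carried
  to the tree by the Fourier transform, using that a bounded operator is determined by its kernel
  (\<open>unitarily_equivalent_kernel_operatorI\<close>).
\<close>

section \<open>Unitaries and bounded kernels on spaces of square summable functions\<close>

lemma ell2_outside: "x \<in> ell2 V \<Longrightarrow> v \<notin> V \<Longrightarrow> x v = 0"
  by (simp add: ell2_def)

lemma ell2_summable: "x \<in> ell2 V \<Longrightarrow> (\<lambda>v. (norm (x v))\<^sup>2) summable_on V"
  by (simp add: ell2_def)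

lemma ell2_finite_sum_le:
  assumes "x \<in> ell2 V" "finite F" "F \<subseteq> V"
  shows "(\<Sum>v\<in>F. (norm (x v))\<^sup>2) \<le> (ell2_norm V x)\<^sup>2"
  using finite_sum_le_infsum[OF ell2_summable[OF assms(1)] assms(2,3)]
  by (simp add: ell2_norm_def infsum_nonneg)

text \<open>Membership and the norm bound both come from a common bound on the finite partial sums,
  which is what estimates of finite submatrices provide.\<close>

lemma ell2_bounded_sums:
  assumes "\<And>v. v \<notin> V \<Longrightarrow> x v = 0"
    and "\<And>F. finite F \<Longrightarrow> F \<subseteq> V \<Longrightarrow> (\<Sum>v\<in>F. (norm (x v))\<^sup>2) \<le> C\<^sup>2" and "C \<ge> 0"
  shows "x \<in> ell2 V" "ell2_norm V x \<le> C"
proof -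
  have s: "(\<lambda>v. (norm (x v))\<^sup>2) summable_on V"
    by (rule nonneg_bounded_partial_sums_imp_summable_on[where C = "C\<^sup>2"])
       (auto intro!: eventually_finite_subsets_at_top_weakI assms)
  then show "x \<in> ell2 V" using assms by (simp add: ell2_def)
  have "infsum (\<lambda>v. (norm (x v))\<^sup>2) V \<le> C\<^sup>2"
    by (rule infsum_le_finite_sums[OF s]) (rule assms)
  then show "ell2_norm V x \<le> C" using \<open>C \<ge> 0\<close>
    by (simp add: ell2_norm_def real_le_lsqrt infsum_nonneg)
qed

lemma summable_on_mult_square:
  fixes x y :: "'a \<Rightarrow> complex"
  assumes "(\<lambda>v. (norm (x v))\<^sup>2) summable_on V" "(\<lambda>v. (norm (y v))\<^sup>2) summable_on V"
  shows "(\<lambda>v. x v * y v) summable_on V"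
proof (rule abs_summable_summable, rule Infinite_Sum.abs_summable_on_comparison_test)
  show "(\<lambda>v. norm ((norm (x v))\<^sup>2 + (norm (y v))\<^sup>2)) summable_on V"
    using summable_on_add[OF assms] by simp
  fix v
  have "2 * norm (x v) * norm (y v) \<le> (norm (x v))\<^sup>2 + (norm (y v))\<^sup>2"
    by (rule sum_squares_bound)
  moreover have "0 \<le> norm (x v) * norm (y v)" by simp
  ultimately show "norm (x v * y v) \<le> norm ((norm (x v))\<^sup>2 + (norm (y v))\<^sup>2)"
    unfolding norm_mult real_norm_def by linarith
qed

lemma ell2_inner_summable:
  assumes "x \<in> ell2 V" "y \<in> ell2 V"
  shows "(\<lambda>v. x v * cnj (y v)) summable_on V"
  using summable_on_mult_square[of x V "\<lambda>v. cnj (y v)"] assms by (simp add: ell2_def)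

lemma ell2_norm_nonneg: "ell2_norm V x \<ge> 0"
  by (simp add: ell2_norm_def infsum_nonneg)

lemma ell2_inner_self:
  assumes "x \<in> ell2 V"
  shows "ell2_inner V x x = of_real ((ell2_norm V x)\<^sup>2)"
proof -
  have "ell2_inner V x x = (\<Sum>\<^sub>\<infinity>v\<in>V. of_real ((norm (x v))\<^sup>2))"
    unfolding ell2_inner_def by (simp only: complex_norm_square)
  also have "\<dots> = of_real (\<Sum>\<^sub>\<infinity>v\<in>V. (norm (x v))\<^sup>2)"
    using has_sum_infsum[OF ell2_summable[OF assms]] by (intro infsumI) (simp only: has_sum_of_real_iff)
  finally show ?thesis by (simp add: ell2_norm_def infsum_nonneg)
qed

lemma ell2_scale:
  assumes "x \<in> ell2 V" shows "(\<lambda>v. c * x v) \<in> ell2 V"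
proof -
  have "(\<lambda>v. (norm c)\<^sup>2 * (norm (x v))\<^sup>2) summable_on V"
    using assms by (intro summable_on_cmult_right) (simp add: ell2_def)
  then show ?thesis using assms by (simp add: ell2_def norm_mult power_mult_distrib)
qed

lemma ell2_add:
  assumes "x \<in> ell2 V" "y \<in> ell2 V" shows "(\<lambda>v. x v + y v) \<in> ell2 V"
proof -
  have "(\<lambda>v. 2 * ((norm (x v))\<^sup>2 + (norm (y v))\<^sup>2)) summable_on V"
    using assms by (intro summable_on_cmult_right summable_on_add) (simp_all add: ell2_def)
  then have "(\<lambda>v. (norm (x v + y v))\<^sup>2) summable_on V"
  proof (rule summable_on_comparison_test)
    fix v
    have "(norm (x v + y v))\<^sup>2 \<le> (norm (x v) + norm (y v))\<^sup>2"
      by (intro power_mono norm_triangle_ineq) auto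
    also have "\<dots> \<le> 2 * ((norm (x v))\<^sup>2 + (norm (y v))\<^sup>2)"
      using sum_squares_bound[of "norm (x v)" "norm (y v)"] by (simp add: power2_sum)
    finally show "(norm (x v + y v))\<^sup>2 \<le> 2 * ((norm (x v))\<^sup>2 + (norm (y v))\<^sup>2)" .
  qed auto
  then show ?thesis using assms by (simp add: ell2_def)
qed

lemma ell2_delta_in: "v \<in> V \<Longrightarrow> ell2_delta v \<in> ell2 V"
  using ell2_finite[of "{v}" V "\<lambda>_. 1"] by (simp add: ell2_delta_def)

lemma ell2_linear_range: "ell2_linear V W A \<Longrightarrow> x \<in> ell2 V \<Longrightarrow> A x \<in> ell2 W"
  by (simp add: ell2_linear_def)

lemma ell2_linear_comp:
  assumes "ell2_linear V W A" "ell2_linear W X B"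
  shows "ell2_linear V X (\<lambda>x. B (A x))"
  using assms unfolding ell2_linear_def by auto

lemma
  assumes "ell2_unitary V W U"
  shows ell2_unitary_linear: "ell2_linear V W U"
    and ell2_unitary_bij: "bij_betw U (ell2 V) (ell2 W)"
    and ell2_unitary_inner: "\<And>x y. x \<in> ell2 V \<Longrightarrow> y \<in> ell2 V \<Longrightarrow>
          ell2_inner W (U x) (U y) = ell2_inner V x y"
  using assms by (auto simp: ell2_unitary_def)

lemma ell2_unitary_norm:
  assumes "ell2_unitary V W U" "x \<in> ell2 V"
  shows "ell2_norm W (U x) = ell2_norm V x"
proof -
  have "complex_of_real ((ell2_norm W (U x))\<^sup>2) = of_real ((ell2_norm V x)\<^sup>2)"
    using ell2_unitary_inner[OF assms(1,2,2)] assms(2)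
      ell2_linear_range[OF ell2_unitary_linear[OF assms(1)] assms(2)]
    by (simp only: ell2_inner_self)
  then have "(ell2_norm W (U x))\<^sup>2 = (ell2_norm V x)\<^sup>2" by (simp only: of_real_eq_iff)
  then show ?thesis by (simp add: ell2_norm_nonneg)
qed

lemma ell2_unitary_comp:
  assumes "ell2_unitary V W U" "ell2_unitary W X T"
  shows "ell2_unitary V X (\<lambda>x. T (U x))"
proof -
  note lU = ell2_unitary_linear[OF assms(1)] and lT = ell2_unitary_linear[OF assms(2)]
  have "bij_betw (\<lambda>x. T (U x)) (ell2 V) (ell2 X)"
    using bij_betw_trans[OF ell2_unitary_bij[OF assms(1)] ell2_unitary_bij[OF assms(2)]]
    by (simp add: comp_def)
  moreover have "ell2_inner X (T (U x)) (T (U y)) = ell2_inner V x y"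
    if "x \<in> ell2 V" "y \<in> ell2 V" for x y
    using ell2_unitary_inner[OF assms(1) that]
      ell2_unitary_inner[OF assms(2) ell2_linear_range[OF lU that(1)] ell2_linear_range[OF lU that(2)]]
    by simp
  ultimately show ?thesis
    using ell2_linear_comp[OF lU lT] by (simp add: ell2_unitary_def)
qed

lemma ell2_unitary_inv:
  assumes U: "ell2_unitary V W U"
  shows "ell2_unitary W V (inv_into (ell2 V) U)"
proof -
  let ?T = "inv_into (ell2 V) U"
  note bij = ell2_unitary_bij[OF U] and lin = ell2_unitary_linear[OF U]
  have T: "?T y \<in> ell2 V" "U (?T y) = y" if "y \<in> ell2 W" for y
    using bij that by (auto simp: bij_betw_def inv_into_into f_inv_into_f)
  have eq: "?T y = x" if "x \<in> ell2 V" "U x = y" for x y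
    using bij that by (auto simp: bij_betw_def)
  have "?T (\<lambda>v. y v + z v) = (\<lambda>v. ?T y v + ?T z v)" if "y \<in> ell2 W" "z \<in> ell2 W" for y z
    using T[OF that(1)] T[OF that(2)] by (intro eq) (simp_all add: ell2_add ell2_linear_add[OF lin])
  moreover have "?T (\<lambda>v. c * y v) = (\<lambda>v. c * ?T y v)" if "y \<in> ell2 W" for y c
    using T[OF that] by (intro eq) (simp_all add: ell2_scale ell2_linear_scale[OF lin])
  moreover have "ell2_inner V (?T y) (?T z) = ell2_inner W y z" if "y \<in> ell2 W" "z \<in> ell2 W" for y z
    using ell2_unitary_inner[OF U T(1)[OF that(1)] T(1)[OF that(2)]] T that by simp
  ultimately show ?thesis
    using T bij_betw_inv_into[OF bij] by (auto simp: ell2_unitary_def ell2_linear_def)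
qed

lemma unitarily_equivalent_sym:
  assumes "unitarily_equivalent V A W B"
  shows "unitarily_equivalent W B V A"
proof -
  obtain U where U: "ell2_unitary V W U" and c: "\<And>x. x \<in> ell2 V \<Longrightarrow> U (A x) = B (U x)"
    and A: "ell2_bounded_operator V A" and B: "ell2_bounded_operator W B"
    using assms unfolding unitarily_equivalent_def by blast
  let ?T = "inv_into (ell2 V) U"
  note bij = ell2_unitary_bij[OF U]
  have "?T (B y) = A (?T y)" if "y \<in> ell2 W" for y
  proof -
    have y: "?T y \<in> ell2 V" "U (?T y) = y"
      using bij that by (auto simp: bij_betw_def inv_into_into f_inv_into_f)
    have "A (?T y) \<in> ell2 V" using A y by (auto simp: ell2_bounded_operator_def ell2_linear_def)
    then have "?T (U (A (?T y))) = A (?T y)" using bij by (auto simp: bij_betw_def)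
    then show ?thesis using c[OF y(1)] y(2) by simp
  qed
  then show ?thesis
    using A B ell2_unitary_inv[OF U] unfolding unitarily_equivalent_def by blast
qed

lemma unitarily_equivalent_trans:
  assumes "unitarily_equivalent V A W B" "unitarily_equivalent W B X C"
  shows "unitarily_equivalent V A X C"
proof -
  obtain U where U: "ell2_unitary V W U" and c: "\<And>x. x \<in> ell2 V \<Longrightarrow> U (A x) = B (U x)"
    and A: "ell2_bounded_operator V A"
    using assms(1) unfolding unitarily_equivalent_def by blast
  obtain T where T: "ell2_unitary W X T" and d: "\<And>x. x \<in> ell2 W \<Longrightarrow> T (B x) = C (T x)"
    and C: "ell2_bounded_operator X C"
    using assms(2) unfolding unitarily_equivalent_def by blast
  have "T (U (A x)) = C (T (U x))" if "x \<in> ell2 V" for x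
    using c[OF that] d[OF ell2_linear_range[OF ell2_unitary_linear[OF U] that]] by simp
  then show ?thesis
    using A C ell2_unitary_comp[OF U T] unfolding unitarily_equivalent_def by blast
qed

text \<open>The bounded operator \<open>U\<^sup>-\<^sup>1 B U\<close> has the kernel \<open>K\<close> because \<open>U\<close> preserves inner products, and a bounded
  operator agrees with the operator of its kernel.  Boundedness of the operator of \<open>K\<close> is thus part
  of the conclusion, inherited from \<open>B\<close>.\<close>

lemma unitarily_equivalent_kernel_operatorI:
  assumes U: "ell2_unitary V W U" and B: "ell2_bounded_operator W B"
    and K: "\<And>v w. v \<in> V \<Longrightarrow> w \<in> V \<Longrightarrow>
        ell2_inner W (B (U (ell2_delta w))) (U (ell2_delta v)) = K v w"
  shows "unitarily_equivalent V (kernel_operator V K) W B"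
proof -
  define T where "T = inv_into (ell2 V) U"
  define A where "A x = T (B (U x))" for x
  have T: "ell2_unitary W V T" unfolding T_def by (rule ell2_unitary_inv[OF U])
  have lB: "ell2_linear W W B" using B by (simp add: ell2_bounded_operator_def)
  note lU = ell2_unitary_linear[OF U] and lT = ell2_unitary_linear[OF T]
  have lin: "ell2_linear V V A"
    unfolding A_def using ell2_linear_comp[OF ell2_linear_comp[OF lU lB] lT] .
  have UA: "U (A x) = B (U x)" if "x \<in> ell2 V" for x
    using ell2_linear_range[OF lB ell2_linear_range[OF lU that]] ell2_unitary_bij[OF U]
    by (auto simp: A_def T_def bij_betw_def f_inv_into_f)
  obtain C where C: "\<And>y. y \<in> ell2 W \<Longrightarrow> ell2_norm W (B y) \<le> C * ell2_norm W y"
    using B by (auto simp: ell2_bounded_operator_def)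
  have "ell2_norm V (A x) \<le> C * ell2_norm V x" if x: "x \<in> ell2 V" for x
    using C[OF ell2_linear_range[OF lU x]] ell2_unitary_norm[OF U x]
      ell2_unitary_norm[OF U ell2_linear_range[OF lin x]] UA[OF x] by simp
  then have bA: "ell2_bounded_operator V A"
    using lin by (auto simp: ell2_bounded_operator_def)
  have "ell2_inner V (A (ell2_delta w)) (ell2_delta v) = K v w" if "v \<in> V" "w \<in> V" for v w
    using K[OF that] UA[OF ell2_delta_in[OF that(2)]]
      ell2_unitary_inner[OF U ell2_linear_range[OF lin] ell2_delta_in[OF that(1)],
        OF ell2_delta_in[OF that(2)]]
    by simp
  then have eq: "A x = kernel_operator V K x" if "x \<in> ell2 V" for x
    using kernel_operator_unique[OF bA _ that] by blast
  have "ell2_linear V V (kernel_operator V K)"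
    unfolding ell2_linear_def
    using ell2_linear_range[OF lin] ell2_linear_add[OF lin] ell2_linear_scale[OF lin]
    by (simp add: eq[symmetric] ell2_add ell2_scale)
  then have "ell2_bounded_operator V (kernel_operator V K)"
    using bA by (simp add: ell2_bounded_operator_def eq)
  moreover have "\<forall>x\<in>ell2 V. U (kernel_operator V K x) = B (U x)"
    using UA eq by simp
  ultimately show ?thesis
    using U B unfolding unitarily_equivalent_def by blast
qed

lemma ell2_inner_kernel_operator_finite:
  assumes F: "finite F" "F \<subseteq> V" "\<And>v. v \<in> V - F \<Longrightarrow> x v = 0"
    and G: "finite G" "G \<subseteq> V" "\<And>v. v \<in> V - G \<Longrightarrow> y v = 0"
  shows "ell2_inner V (kernel_operator V K x) y = (\<Sum>v\<in>G. \<Sum>w\<in>F. K v w * x w * cnj (y v))"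
proof -
  have 1: "kernel_operator V K x v = (\<Sum>w\<in>F. K v w * x w)" if "v \<in> V" for v
  proof -
    have "(\<Sum>\<^sub>\<infinity>w\<in>V. K v w * x w) = (\<Sum>\<^sub>\<infinity>w\<in>F. K v w * x w)"
      by (rule infsum_cong_neutral) (use F in auto)
    then show ?thesis using that F by (simp add: kernel_operator_def)
  qed
  have "ell2_inner V (kernel_operator V K x) y = (\<Sum>\<^sub>\<infinity>v\<in>G. kernel_operator V K x v * cnj (y v))"
    unfolding ell2_inner_def by (rule infsum_cong_neutral) (use G in auto)
  also have "\<dots> = (\<Sum>v\<in>G. \<Sum>w\<in>F. K v w * x w * cnj (y v))"
    using G 1 by (auto intro!: sum.cong simp: sum_distrib_right)
  finally show ?thesis .
qed

lemma ell2_unitary_reindex: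
  assumes "bij_betw \<pi> W V"
  shows "ell2_unitary V W (\<lambda>x w. if w \<in> W then x (\<pi> w) else 0)"
proof -
  let ?U = "\<lambda>x w. if w \<in> W then x (\<pi> w) else (0::complex)"
  define \<rho> where "\<rho> = inv_into W \<pi>"
  let ?T = "\<lambda>y v. if v \<in> V then y (\<rho> v) else (0::complex)"
  have \<rho>: "bij_betw \<rho> V W" unfolding \<rho>_def by (rule bij_betw_inv_into[OF assms])
  have in_ell2: "(\<lambda>w. if w \<in> A then x (g w) else 0) \<in> ell2 A"
    if "bij_betw g A B" "x \<in> ell2 B" for A :: "'c set" and B :: "'d set" and g x
  proof -
    have "(\<lambda>w. (norm (x (g w)))\<^sup>2) summable_on A"
      using that summable_on_reindex_bij_betw[OF that(1), of "\<lambda>v. (norm (x v))\<^sup>2"]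
      by (simp add: ell2_def)
    then show ?thesis by (simp add: ell2_def cong: summable_on_cong)
  qed
  have "bij_betw ?U (ell2 V) (ell2 W)"
  proof (rule bij_betw_byWitness[where f' = ?T])
    show "\<forall>x\<in>ell2 V. ?T (?U x) = x"
      using assms \<rho> by (auto simp: fun_eq_iff \<rho>_def ell2_outside bij_betw_inv_into_right bij_betw_apply)
    show "\<forall>y\<in>ell2 W. ?U (?T y) = y"
      using assms \<rho> by (auto simp: fun_eq_iff \<rho>_def ell2_outside bij_betw_inv_into_left bij_betw_apply)
    show "?U ` ell2 V \<subseteq> ell2 W" "?T ` ell2 W \<subseteq> ell2 V"
      using in_ell2[OF assms] in_ell2[OF \<rho>] by auto
  qed
  moreover have "ell2_inner W (?U x) (?U y) = ell2_inner V x y" for x y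
    using infsum_reindex_bij_betw[OF assms, of "\<lambda>v. x v * cnj (y v)"]
    by (simp add: ell2_inner_def cong: infsum_cong)
  ultimately show ?thesis
    using in_ell2[OF assms] by (auto simp: ell2_unitary_def ell2_linear_def)
qed

text \<open>A uniform bound on all finite rectangular submatrices suffices.  Applied to a single row and to the
  conjugate of that row it shows that rows are square summable, so the series defining the operator
  converge; the bound then passes to the limit in the columns.\<close>

lemma kernel_operator_bounded:
  assumes C: "C \<ge> 0" and K: "\<And>F G x. finite F \<Longrightarrow> F \<subseteq> V \<Longrightarrow> finite G \<Longrightarrow> G \<subseteq> V \<Longrightarrow>
     (\<Sum>a\<in>F. (norm (\<Sum>b\<in>G. K a b * x b))\<^sup>2) \<le> C\<^sup>2 * (\<Sum>b\<in>G. (norm (x b))\<^sup>2)"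
  shows "ell2_bounded_operator V (kernel_operator V K)"
proof -
  have row: "(\<lambda>b. (norm (K a b))\<^sup>2) summable_on V" if a: "a \<in> V" for a
  proof (rule nonneg_bounded_partial_sums_imp_summable_on[where C = "C\<^sup>2"])
    have "(\<Sum>b\<in>G. (norm (K a b))\<^sup>2) \<le> C\<^sup>2" if G: "finite G" "G \<subseteq> V" for G
    proof -
      let ?S = "\<Sum>b\<in>G. (norm (K a b))\<^sup>2"
      have "(\<Sum>b\<in>G. K a b * cnj (K a b)) = of_real ?S"
        by (simp only: complex_norm_square[symmetric] of_real_sum of_real_power)
      then have "norm (\<Sum>b\<in>G. K a b * cnj (K a b)) = ?S"
        by (simp only: norm_of_real abs_of_nonneg sum_nonneg zero_le_power2)
      \<comment> \<open>The hypothesis with the one row \<open>a\<close> and the vector \<open>cnj (K a b)\<close>.\<close>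
      then have le: "?S\<^sup>2 \<le> C\<^sup>2 * ?S"
        using K[of "{a}" G "\<lambda>b. cnj (K a b)"] a G by simp
      show ?thesis
      proof (cases "?S = 0")
        case False
        then have "?S > 0" by (simp add: sum_nonneg order_less_le)
        then show ?thesis using le by (simp add: power2_eq_square)
      qed simp
    qed
    then show "\<forall>\<^sub>F G in finite_subsets_at_top V. (\<Sum>b\<in>G. (norm (K a b))\<^sup>2) \<le> C\<^sup>2"
      by (auto intro!: eventually_finite_subsets_at_top_weakI)
  qed simp
  have summ: "(\<lambda>b. K a b * x b) summable_on V" if "a \<in> V" "x \<in> ell2 V" for a x
    by (rule summable_on_mult_square[OF row[OF that(1)] ell2_summable[OF that(2)]])
  have bound: "(\<Sum>a\<in>F. (norm (kernel_operator V K x a))\<^sup>2) \<le> (C * ell2_norm V x)\<^sup>2"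
    if x: "x \<in> ell2 V" and F: "finite F" "F \<subseteq> V" for x F
  proof (rule tendsto_upperbound)
    have "((\<lambda>G. \<Sum>b\<in>G. K a b * x b) \<longlongrightarrow> kernel_operator V K x a) (finite_subsets_at_top V)"
      if "a \<in> F" for a
      using has_sum_infsum[OF summ[of a x]] that F x
      by (auto simp: has_sum_def kernel_operator_def)
    then show "((\<lambda>G. \<Sum>a\<in>F. (norm (\<Sum>b\<in>G. K a b * x b))\<^sup>2) \<longlongrightarrow>
        (\<Sum>a\<in>F. (norm (kernel_operator V K x a))\<^sup>2)) (finite_subsets_at_top V)"
      by (intro tendsto_intros)
    have "(\<Sum>a\<in>F. (norm (\<Sum>b\<in>G. K a b * x b))\<^sup>2) \<le> (C * ell2_norm V x)\<^sup>2"
      if G: "finite G" "G \<subseteq> V" for G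
    proof -
      have "(\<Sum>a\<in>F. (norm (\<Sum>b\<in>G. K a b * x b))\<^sup>2) \<le> C\<^sup>2 * (\<Sum>b\<in>G. (norm (x b))\<^sup>2)"
        by (rule K[OF F G])
      also have "\<dots> \<le> C\<^sup>2 * (ell2_norm V x)\<^sup>2"
        by (intro mult_left_mono ell2_finite_sum_le[OF x G]) simp
      finally show ?thesis by (simp add: power_mult_distrib)
    qed
    then show "\<forall>\<^sub>F G in finite_subsets_at_top V.
        (\<Sum>a\<in>F. (norm (\<Sum>b\<in>G. K a b * x b))\<^sup>2) \<le> (C * ell2_norm V x)\<^sup>2"
      by (auto intro!: eventually_finite_subsets_at_top_weakI)
  qed simp
  have out: "kernel_operator V K x v = 0" if "v \<notin> V" for x v
    using that by (simp add: kernel_operator_def)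
  have Cx: "0 \<le> C * ell2_norm V x" for x using mult_nonneg_nonneg[OF C ell2_norm_nonneg] .
  have "ell2_linear V V (kernel_operator V K)"
    unfolding ell2_linear_def
  proof (intro conjI ballI allI)
    show "kernel_operator V K x \<in> ell2 V" if "x \<in> ell2 V" for x
      by (rule ell2_bounded_sums(1)[OF out bound[OF that] Cx])
    show "kernel_operator V K (\<lambda>v. x v + y v) = (\<lambda>w. kernel_operator V K x w + kernel_operator V K y w)"
      if "x \<in> ell2 V" "y \<in> ell2 V" for x y
      using summ[OF _ that(1)] summ[OF _ that(2)]
      by (auto simp: kernel_operator_def fun_eq_iff distrib_left infsum_add)
    show "kernel_operator V K (\<lambda>v. c * x v) = (\<lambda>w. c * kernel_operator V K x w)" for c x
      by (auto simp: kernel_operator_def fun_eq_iff mult.left_commute[of _ c] infsum_cmult_right')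
  qed
  moreover have "ell2_norm V (kernel_operator V K x) \<le> C * ell2_norm V x" if "x \<in> ell2 V" for x
    by (rule ell2_bounded_sums(2)[OF out bound[OF that] Cx])
  ultimately show ?thesis by (auto simp: ell2_bounded_operator_def)
qed

section \<open>Unitaries acting level by level\<close>

lemma infsum_by_levels:
  fixes g :: "'a \<Rightarrow> 'b::banach" and l :: "'a \<Rightarrow> 'c"
  assumes "g summable_on V" "\<And>n. finite {v \<in> V. l v = n}"
  shows "infsum g V = (\<Sum>\<^sub>\<infinity>n. \<Sum>v | v \<in> V \<and> l v = n. g v)"
proof -
  let ?S = "Sigma UNIV (\<lambda>n. {v \<in> V. l v = n})"
  have b: "bij_betw snd ?S V"
    by (rule bij_betw_byWitness[where f' = "\<lambda>v. (l v, v)"]) auto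
  have s: "(\<lambda>z. g (snd z)) summable_on ?S"
    using summable_on_reindex_bij_betw[OF b] assms by blast
  have "infsum g V = infsum (\<lambda>z. g (snd z)) ?S"
    using infsum_reindex_bij_betw[OF b, of g] by simp
  also have "\<dots> = (\<Sum>\<^sub>\<infinity>n. \<Sum>\<^sub>\<infinity>v | v \<in> V \<and> l v = n. g v)"
    using infsum_Sigma_banach[OF s] by simp
  finally show ?thesis using assms by simp
qed

text \<open>Only the entries of \<open>E\<close> within a level set of \<open>l\<close> enter, so \<open>E\<close> acts as a block diagonal matrix.\<close>

definition level_transform ::
    "'a set \<Rightarrow> ('a \<Rightarrow> 'c) \<Rightarrow> ('a \<Rightarrow> 'a \<Rightarrow> complex) \<Rightarrow> ('a \<Rightarrow> complex) \<Rightarrow> ('a \<Rightarrow> complex)" where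
  "level_transform V l E x =
     (\<lambda>b. if b \<in> V then \<Sum>a | a \<in> V \<and> l a = l b. E b a * x a else 0)"

text \<open>Orthonormality of the columns makes each block an isometry.\<close>

lemma level_transform_level:
  assumes fin: "\<And>n. finite {v \<in> V. l v = n}"
    and col: "\<And>a a'. a \<in> V \<Longrightarrow> a' \<in> V \<Longrightarrow> l a = l a' \<Longrightarrow>
       (\<Sum>b | b \<in> V \<and> l b = l a. E b a * cnj (E b a')) = (if a = a' then 1 else 0)"
  shows "(\<Sum>b | b \<in> V \<and> l b = n. level_transform V l E x b * cnj (level_transform V l E y b))
       = (\<Sum>a | a \<in> V \<and> l a = n. x a * cnj (y a))"
proof -
  let ?L = "{a \<in> V. l a = n}"
  have c: "(\<Sum>b\<in>?L. E b a * cnj (E b a')) = (if a = a' then 1 else 0)"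
    if "a \<in> ?L" "a' \<in> ?L" for a a'
    using col[of a a'] that by simp
  have "(\<Sum>b\<in>?L. level_transform V l E x b * cnj (level_transform V l E y b))
      = (\<Sum>b\<in>?L. (\<Sum>a\<in>?L. E b a * x a) * cnj (\<Sum>a\<in>?L. E b a * y a))"
    by (intro sum.cong refl) (auto simp: level_transform_def)
  also have "\<dots> = (\<Sum>b\<in>?L. \<Sum>a\<in>?L. \<Sum>a'\<in>?L. x a * cnj (y a') * (E b a * cnj (E b a')))"
    by (simp add: sum_product mult_ac)
  also have "\<dots> = (\<Sum>a\<in>?L. \<Sum>b\<in>?L. \<Sum>a'\<in>?L. x a * cnj (y a') * (E b a * cnj (E b a')))"
    by (rule sum.swap)
  also have "\<dots> = (\<Sum>a\<in>?L. \<Sum>a'\<in>?L. \<Sum>b\<in>?L. x a * cnj (y a') * (E b a * cnj (E b a')))"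
    by (intro sum.cong refl sum.swap)
  also have "\<dots> = (\<Sum>a\<in>?L. \<Sum>a'\<in>?L. if a = a' then x a * cnj (y a') else 0)"
    by (intro sum.cong refl) (simp only: sum_distrib_left[symmetric] c, simp)
  also have "\<dots> = (\<Sum>a\<in>?L. x a * cnj (y a))"
    using fin[of n] by simp
  finally show ?thesis .
qed

lemma level_transform_in_ell2:
  fixes V :: "'a set"
  assumes fin: "\<And>n. finite {v \<in> V. l v = n}"
    and col: "\<And>a a'. a \<in> V \<Longrightarrow> a' \<in> V \<Longrightarrow> l a = l a' \<Longrightarrow>
       (\<Sum>b | b \<in> V \<and> l b = l a. E b a * cnj (E b a')) = (if a = a' then 1 else 0)"
    and x: "x \<in> ell2 V"
  shows "level_transform V l E x \<in> ell2 V"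
proof (rule ell2_bounded_sums(1))
  let ?T = "level_transform V l E"
  fix F assume F: "finite F" "F \<subseteq> V"
  define H where "H = (\<Union>n\<in>l ` F. {v \<in> V. l v = n})"
  have H: "finite H" "F \<subseteq> H" "H \<subseteq> V" using F fin by (auto simp: H_def)
  have split: "sum g H = (\<Sum>n\<in>l ` F. \<Sum>v | v \<in> V \<and> l v = n. g v)" for g :: "'a \<Rightarrow> real"
    unfolding H_def by (rule sum.UNION_disjoint) (use F fin in auto)
  have lev: "(\<Sum>v | v \<in> V \<and> l v = n. (norm (?T x v))\<^sup>2) = (\<Sum>v | v \<in> V \<and> l v = n. (norm (x v))\<^sup>2)" for n
  proof -
    have "complex_of_real (\<Sum>v | v \<in> V \<and> l v = n. (norm (?T x v))\<^sup>2)
        = of_real (\<Sum>v | v \<in> V \<and> l v = n. (norm (x v))\<^sup>2)"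
      using level_transform_level[where V = V and l = l and E = E and n = n and x = x and y = x, OF fin col]
      by (simp only: of_real_sum complex_norm_square)
    then show ?thesis by (simp only: of_real_eq_iff)
  qed
  have "(\<Sum>v\<in>F. (norm (?T x v))\<^sup>2) \<le> (\<Sum>v\<in>H. (norm (?T x v))\<^sup>2)"
    using H by (intro sum_mono2) auto
  also have "\<dots> = (\<Sum>v\<in>H. (norm (x v))\<^sup>2)" by (simp only: split lev)
  also have "\<dots> \<le> (ell2_norm V x)\<^sup>2" by (rule ell2_finite_sum_le[OF x H(1,3)])
  finally show "(\<Sum>v\<in>F. (norm (?T x v))\<^sup>2) \<le> (ell2_norm V x)\<^sup>2" .
qed (auto simp: level_transform_def ell2_norm_nonneg)

lemma level_transform_inverse:
  assumes fin: "\<And>n. finite {v \<in> V. l v = n}"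
    and col: "\<And>a a'. a \<in> V \<Longrightarrow> a' \<in> V \<Longrightarrow> l a = l a' \<Longrightarrow>
       (\<Sum>b | b \<in> V \<and> l b = l a. D a b * E b a') = (if a = a' then 1 else 0)"
    and x: "x \<in> ell2 V"
  shows "level_transform V l D (level_transform V l E x) = x"
proof
  fix a
  show "level_transform V l D (level_transform V l E x) a = x a"
  proof (cases "a \<in> V")
    case True
    let ?L = "{b \<in> V. l b = l a}"
    have c: "(\<Sum>b\<in>?L. D a b * E b a') = (if a = a' then 1 else 0)" if "a' \<in> ?L" for a'
      using col[of a a'] that True by simp
    have "level_transform V l D (level_transform V l E x) a
        = (\<Sum>b\<in>?L. D a b * (\<Sum>a'\<in>?L. E b a' * x a'))"
      using True by (auto simp: level_transform_def intro!: sum.cong)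
    also have "\<dots> = (\<Sum>b\<in>?L. \<Sum>a'\<in>?L. D a b * E b a' * x a')"
      by (simp add: sum_distrib_left mult.assoc)
    also have "\<dots> = (\<Sum>a'\<in>?L. \<Sum>b\<in>?L. D a b * E b a' * x a')"
      by (rule sum.swap)
    also have "\<dots> = (\<Sum>a'\<in>?L. (\<Sum>b\<in>?L. D a b * E b a') * x a')"
      by (simp add: sum_distrib_right)
    also have "\<dots> = (\<Sum>a'\<in>?L. if a = a' then x a' else 0)"
      by (intro sum.cong refl) (simp only: c, simp)
    finally show ?thesis using True fin by simp
  qed (use x in \<open>simp add: level_transform_def ell2_outside\<close>)
qed

text \<open>With finite levels, everything about the infinite matrix reduces to its finite blocks: they
  are isometric, hence so is the whole transform, and the conjugate transpose inverts it
  block by block.\<close>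

lemma level_transform_unitary:
  assumes fin: "\<And>n. finite {v \<in> V. l v = n}"
    and row: "\<And>b b'. b \<in> V \<Longrightarrow> b' \<in> V \<Longrightarrow> l b = l b' \<Longrightarrow>
       (\<Sum>a | a \<in> V \<and> l a = l b. E b a * cnj (E b' a)) = (if b = b' then 1 else 0)"
    and col: "\<And>a a'. a \<in> V \<Longrightarrow> a' \<in> V \<Longrightarrow> l a = l a' \<Longrightarrow>
       (\<Sum>b | b \<in> V \<and> l b = l a. E b a * cnj (E b a')) = (if a = a' then 1 else 0)"
  shows "ell2_unitary V V (level_transform V l E)"
proof -
  let ?U = "level_transform V l E" and ?T = "level_transform V l (\<lambda>a b. cnj (E b a))"
  have U: "?U x \<in> ell2 V" if "x \<in> ell2 V" for x
    by (rule level_transform_in_ell2[where V = V and l = l and E = E, OF fin col that])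
  have row': "(\<Sum>a | a \<in> V \<and> l a = l b. cnj (E b a) * cnj (cnj (E b' a))) = (if b = b' then 1 else 0)"
    if "b \<in> V" "b' \<in> V" "l b = l b'" for b b'
    using row[OF that(2,1) that(3)[symmetric]] that(3) by (simp add: mult.commute split: if_splits)
  have T: "?T x \<in> ell2 V" if "x \<in> ell2 V" for x
    by (rule level_transform_in_ell2[where V = V and l = l and E = "\<lambda>a b. cnj (E b a)", OF fin row' that])
  have col': "(\<Sum>b | b \<in> V \<and> l b = l a. cnj (E b a) * E b a') = (if a = a' then 1 else 0)"
    if "a \<in> V" "a' \<in> V" "l a = l a'" for a a'
    using col[OF that(2,1) that(3)[symmetric]] that(3) by (simp add: mult.commute split: if_splits)
  have "bij_betw ?U (ell2 V) (ell2 V)"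
  proof (rule bij_betw_byWitness[where f' = ?T])
    show "\<forall>x\<in>ell2 V. ?T (?U x) = x"
      by (intro ballI level_transform_inverse[where V = V and l = l and E = E and D = "\<lambda>a b. cnj (E b a)", OF fin col'])
    show "\<forall>x\<in>ell2 V. ?U (?T x) = x"
      by (intro ballI level_transform_inverse[where V = V and l = l and D = E and E = "\<lambda>a b. cnj (E b a)", OF fin row])
  qed (use U T in auto)
  moreover have "ell2_inner V (?U x) (?U y) = ell2_inner V x y" if x: "x \<in> ell2 V" and y: "y \<in> ell2 V" for x y
  proof -
    have "ell2_inner V (?U x) (?U y) = (\<Sum>\<^sub>\<infinity>n. \<Sum>b | b \<in> V \<and> l b = n. ?U x b * cnj (?U y b))"
      unfolding ell2_inner_def
      by (rule infsum_by_levels[OF ell2_inner_summable[OF U[OF x] U[OF y]] fin])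
    also have "\<dots> = (\<Sum>\<^sub>\<infinity>n. \<Sum>a | a \<in> V \<and> l a = n. x a * cnj (y a))"
      by (intro infsum_cong level_transform_level[OF fin col])
    also have "\<dots> = ell2_inner V x y"
      unfolding ell2_inner_def
      by (rule infsum_by_levels[OF ell2_inner_summable[OF x y] fin, symmetric])
    finally show ?thesis .
  qed
  moreover have "ell2_linear V V ?U"
    unfolding ell2_linear_def
  proof (intro conjI ballI allI)
    show "?U (\<lambda>v. x v + y v) = (\<lambda>b. ?U x b + ?U y b)" for x y
      by (rule ext) (simp add: level_transform_def sum.distrib distrib_left)
    show "?U (\<lambda>v. c * x v) = (\<lambda>b. c * ?U x b)" for c x
      by (rule ext) (simp add: level_transform_def sum_distrib_left mult.left_commute)
  qed (rule U)
  ultimately show ?thesis by (simp add: ell2_unitary_def)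
qed

section \<open>Ancestors in the tree\<close>

text \<open>An edge changes the length of a word by one.  This is the lower bound on distances.\<close>

lemma tree_edge_path_length:
  assumes "(s, t) \<in> tree_edges q ^^ n"
  shows "\<bar>int (length s) - int (length t)\<bar> \<le> int n"
  using assms
proof (induction n arbitrary: t)
  case (Suc n)
  then obtain u where u: "(s, u) \<in> tree_edges q ^^ n" "(u, t) \<in> tree_edges q" by auto
  from u(2) have "\<bar>int (length u) - int (length t)\<bar> \<le> 1"
    by (auto simp: tree_edges_def)
  with Suc.IH[OF u(1)] show ?case by simp
qed simp

lemma tree_edge_path_sym:
  assumes "(s, t) \<in> tree_edges q ^^ n"
  shows "(t, s) \<in> tree_edges q ^^ n"
  using assms
proof (induction n arbitrary: t)
  case (Suc n)
  then obtain u where "(s, u) \<in> tree_edges q ^^ n" "(u, t) \<in> tree_edges q" by auto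
  then show ?case
    using Suc.IH relpow_Suc_I2[of t u "tree_edges q" s n] by (auto simp: tree_edges_def)
qed simp

lemma tree_edge_path_append:
  assumes "s @ u \<in> tree q"
  shows "(s, s @ u) \<in> tree_edges q ^^ length u"
  using assms
proof (induction u rule: rev_induct)
  case (snoc i u)
  have "(s @ u, s @ u @ [i]) \<in> tree_edges q"
    using snoc.prems by (auto simp: tree_edges_def tree_def)
  with snoc show ?case by (auto simp: tree_def)
qed simp

lemma tree_dist_append:
  assumes "s @ u \<in> tree q"
  shows "tree_dist q s (s @ u) = length u" "tree_dist q (s @ u) s = length u"
proof -
  have "length u \<le> n" if "(s, s @ u) \<in> tree_edges q ^^ n \<or> (s @ u, s) \<in> tree_edges q ^^ n" for n
    using that tree_edge_path_length[of s "s @ u" n q] tree_edge_path_length[of "s @ u" s n q]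
    by auto
  moreover have p: "(s, s @ u) \<in> tree_edges q ^^ length u"
    by (rule tree_edge_path_append[OF assms])
  moreover have "(s @ u, s) \<in> tree_edges q ^^ length u"
    by (rule tree_edge_path_sym[OF p])
  ultimately show "tree_dist q s (s @ u) = length u" "tree_dist q (s @ u) s = length u"
    unfolding tree_dist_def by (auto intro!: Least_equality)
qed

lemma tree_level_eq_length: "s \<in> tree q \<Longrightarrow> tree_level q s = length s"
  using tree_dist_append(1)[of "[]" s q] by (simp add: tree_level_def)

lemma tree_path_exists:
  assumes "s \<in> tree q" "t \<in> tree q"
  shows "(s, t) \<in> tree_edges q ^^ (length s + length t)"
proof -
  have "([], s) \<in> tree_edges q ^^ length s" "([], t) \<in> tree_edges q ^^ length t"
    using tree_edge_path_append[of "[]"] assms by auto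
  then show ?thesis using tree_edge_path_sym[of "[]" s] by (auto simp: relpow_add)
qed

text \<open>The vertex number \<open>n\<close> of a ray from the root has distance \<open>n\<close> from the root, hence length \<open>n\<close>; two
  consecutive vertices are joined by an edge, which then must lead to a child.\<close>

lemma root_ray_step:
  assumes "root_ray q r"
  shows "length (r n) = n" "\<exists>i. r (Suc n) = r n @ [i]"
proof -
  have tr: "r m \<in> tree q" for m using assms by (auto simp: root_ray_def)
  have r: "r 0 = []" "int (tree_dist q (r m) (r k)) = \<bar>int m - int k\<bar>" for m k
    using assms by (auto simp: root_ray_def)
  have len: "length (r m) = m" for m
    using r(2)[of 0 m] tree_level_eq_length[OF tr[of m]] by (simp add: r(1) tree_level_def)
  then show "length (r n) = n" .
  have "tree_dist q (r n) (r (Suc n)) = 1" using r(2)[of n "Suc n"] by simp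
  moreover have "(r n, r (Suc n)) \<in> tree_edges q ^^ tree_dist q (r n) (r (Suc n))"
    unfolding tree_dist_def by (rule LeastI) (rule tree_path_exists[OF tr tr])
  ultimately have "(r n, r (Suc n)) \<in> tree_edges q" by simp
  then show "\<exists>i. r (Suc n) = r n @ [i]"
    using len[of n] len[of "Suc n"] by (auto simp: tree_edges_def)
qed

lemma root_ray_prefix:
  assumes "root_ray q r" "m \<le> n"
  shows "prefix (r m) (r n)"
  using assms(2)
proof (induction n rule: dec_induct)
  case (step n)
  then show ?case using root_ray_step(2)[OF assms(1), of n] by (auto intro: prefix_order.trans)
qed simp

text \<open>Every vertex lies on a ray: follow its word, then always take the child number \<open>0\<close>.\<close>

lemma root_ray_through:
  assumes "t \<in> tree q" "q > 0"
  shows "root_ray q (\<lambda>n. take n t @ replicate (n - length t) 0)"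
proof -
  define r where "r = (\<lambda>n. take n t @ replicate (n - length t) (0::nat))"
  have tr: "r n \<in> tree q" for n
    using assms by (auto simp: r_def tree_def in_lists_conv_set dest: in_set_takeD)
  have "prefix (r m) (r n)" if "m \<le> n" for m n
  proof -
    have "r m = take m (r n)"
      using that by (auto simp: r_def min_def)
    then show ?thesis by (metis take_is_prefix)
  qed
  moreover have len: "length (r n) = n" for n by (simp add: r_def)
  ultimately have ex: "\<exists>u. r n = r m @ u \<and> length u = n - m" if "m \<le> n" for m n
    using that by (metis prefixE length_append diff_add_inverse)
  have d: "tree_dist q (r m) (r n) = n - m \<and> tree_dist q (r n) (r m) = n - m" if "m \<le> n" for m n
    using ex[OF that] tr[of n] tree_dist_append by metis
  have "int (tree_dist q (r m) (r n)) = \<bar>int m - int n\<bar>" for m n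
    using d[of m n] d[of n m] by (cases "m \<le> n") auto
  then have "root_ray q r"
    using tr by (auto simp: root_ray_def r_def)
  then show ?thesis by (simp add: r_def)
qed

lemma tree_le_iff_prefix:
  assumes "s \<in> tree q" "t \<in> tree q" "q > 0"
  shows "tree_le q s t \<longleftrightarrow> prefix s t"
proof
  assume "tree_le q s t"
  then obtain r m n where r: "root_ray q r" "s = r m" "t = r n"
    and l: "tree_level q s \<le> tree_level q t"
    by (auto simp: tree_le_def)
  then show "prefix s t"
    using root_ray_prefix[OF r(1)] root_ray_step(1)[OF r(1)] assms by (simp add: tree_level_eq_length)
next
  assume p: "prefix s t"
  define r where "r = (\<lambda>n. take n t @ replicate (n - length t) (0::nat))"
  have "root_ray q r" unfolding r_def by (rule root_ray_through[OF assms(2,3)])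
  moreover have "s = r (length s)" "t = r (length t)"
    using p prefix_length_le[OF p] by (auto simp: r_def prefix_def)
  ultimately show "tree_le q s t"
    using prefix_length_le[OF p] assms by (auto simp: tree_le_def tree_level_eq_length)
qed

lemma Gamma_kernel_append:
  assumes "s @ u \<in> tree q" "q > 0"
  shows "Gamma_kernel q f (s @ u) s =
           of_real (q powr (- real (length u) / 2)) * fourier_coeff f (int (length u))"
    and "Gamma_kernel q f s (s @ u) =
           of_real (q powr (- real (length u) / 2)) * fourier_coeff f (- int (length u))"
proof -
  have s: "s \<in> tree q" using assms(1) by (auto simp: tree_def)
  have "(s, s @ u) \<in> comparable_pairs q" "(s @ u, s) \<in> comparable_pairs q"
    using assms s by (auto simp: comparable_pairs_def tree_le_iff_prefix)
  then show "Gamma_kernel q f (s @ u) s =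
           of_real (q powr (- real (length u) / 2)) * fourier_coeff f (int (length u))"
    and "Gamma_kernel q f s (s @ u) =
           of_real (q powr (- real (length u) / 2)) * fourier_coeff f (- int (length u))"
    using assms(1) s by (simp_all add: Gamma_kernel_def tree_dist_append tree_level_eq_length)
qed

lemma Gamma_kernel_incomparable:
  assumes "s \<in> tree q" "t \<in> tree q" "q > 0" "\<not> prefix s t" "\<not> prefix t s"
  shows "Gamma_kernel q f s t = 0"
  using assms by (simp add: Gamma_kernel_def comparable_pairs_def tree_le_iff_prefix)

section \<open>The Fourier transform on the levels of the tree\<close>

text \<open>The unitary matrix of the discrete Fourier transform on \<open>\<int>/q\<close>.  What matters is that
  it is unitary and that its row for the frequency \<open>0\<close> is constant; its symmetry lets rows and
  columns be treated alike.\<close>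

definition dft :: "nat \<Rightarrow> nat \<Rightarrow> nat \<Rightarrow> complex" where
  "dft q i j = exp (2 * of_real pi * \<i> * of_nat i / of_nat q) ^ j / of_real (sqrt (real q))"

lemma dft_sym: "dft q i j = dft q j i"
  by (simp add: dft_def flip: exp_of_nat_mult) (simp add: mult_ac)

lemma dft_zero: "dft q 0 j = 1 / of_real (sqrt (real q))"
  by (simp add: dft_def)

lemma dft_orthonormal:
  assumes "i < q" "i' < q"
  shows "(\<Sum>j<q. dft q i j * cnj (dft q i' j)) = (if i = i' then 1 else 0)"
proof -
  define e where "e = (\<lambda>i. exp (2 * of_real pi * \<i> * of_nat i / of_nat q :: complex))"
  have q: "q > 0" using assms by simp
  have norm: "e i * cnj (e i) = 1" for i
    by (simp add: e_def complex_norm_square[symmetric] norm_exp_eq_Re flip: power2_eq_square)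
  have pow: "e i ^ q = 1" for i
    unfolding e_def by (rule complex_root_unity) (use q in simp)
  define z where "z = e i * cnj (e i')"
  have zq: "z ^ q = 1"
    using pow by (simp add: z_def power_mult_distrib flip: complex_cnj_power)
  have z1: "z = 1 \<longleftrightarrow> i = i'"
  proof
    assume "z = 1"
    then have "e i = e i'"
      using norm[of i'] by (metis z_def mult.assoc mult.commute mult.right_neutral)
    then show "i = i'"
      using complex_root_unity_eq[of q i i'] assms by (simp add: e_def)
  qed (simp add: z_def norm)
  have "(\<Sum>j<q. dft q i j * cnj (dft q i' j)) = (\<Sum>j<q. z ^ j / of_nat q)"
    by (intro sum.cong refl)
       (simp add: dft_def e_def z_def power_mult_distrib flip: of_real_mult)
  also have "\<dots> = (if i = i' then 1 else 0)"
    using z1 zq q geometric_sum[of z q] by (auto simp flip: sum_divide_distrib)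
  finally show ?thesis .
qed

text \<open>The normalized characters of \<open>(\<int>/q)\<^sup>m\<close>: products of characters of the factors, with value \<open>0\<close> when
  the frequency and the vertex have different levels.\<close>

fun character :: "nat \<Rightarrow> nat list \<Rightarrow> nat list \<Rightarrow> complex" where
  "character q [] [] = 1"
| "character q (i # k) (j # v) = dft q i j * character q k v"
| "character q _ _ = 0"

lemma character_sym: "character q k v = character q v k"
  by (induction q k v rule: character.induct) (auto simp: dft_sym)

lemma character_append:
  "length k = length v \<Longrightarrow> character q (k @ k') (v @ v') = character q k v * character q k' v'"
  by (induction k v rule: list_induct2) auto

text \<open>Trailing zero frequencies contribute only the normalization.  This is where the weight
  \<open>q\<^sup>-\<^sup>d\<^sup>/\<^sup>2\<close> of the kernel on the tree comes from.\<close>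

lemma character_zeros:
  "character q (replicate (length v) 0) v = (1 / of_real (sqrt (real q))) ^ length v"
  by (induction v) (auto simp: dft_zero)

lemma finite_tree_level: "finite {v \<in> tree q. length v = n}"
  using finite_lists_length_eq[of "{..<q}" n] by (simp add: tree_def lists_eq_set)

lemma sum_tree_level_Suc:
  "(\<Sum>v | v \<in> tree q \<and> length v = Suc n. g v) = (\<Sum>j<q. \<Sum>v | v \<in> tree q \<and> length v = n. g (j # v))"
proof -
  let ?L = "{v \<in> tree q. length v = n}"
  have "(\<Sum>v | v \<in> tree q \<and> length v = Suc n. g v) = (\<Sum>(j, v)\<in>{..<q} \<times> ?L. g (j # v))"
    by (rule sum.reindex_bij_witness[of _ "\<lambda>(j, v). j # v" "\<lambda>v. (hd v, tl v)"])
       (auto simp: tree_def length_Suc_conv)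
  then show ?thesis by (simp add: sum.cartesian_product)
qed

text \<open>The sum over a level factorizes over the letters of the word.\<close>

lemma character_orthonormal:
  assumes "k \<in> tree q" "k' \<in> tree q" "length k = length k'"
  shows "(\<Sum>v | v \<in> tree q \<and> length v = length k. character q k v * cnj (character q k' v))
       = (if k = k' then 1 else 0)"
  using assms(3,1,2)
proof (induction k k' rule: list_induct2)
  case Nil
  have "{v \<in> tree q. length v = 0} = {[]}" by (auto simp: tree_def)
  then show ?case by simp
next
  case (Cons i k i' k')
  have "(\<Sum>v | v \<in> tree q \<and> length v = length (i # k). character q (i # k) v * cnj (character q (i' # k') v))
      = (\<Sum>j<q. dft q i j * cnj (dft q i' j)) *
        (\<Sum>v | v \<in> tree q \<and> length v = length k. character q k v * cnj (character q k' v))"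
    by (simp add: sum_tree_level_Suc sum_product mult_ac)
  then show ?case
    using Cons dft_orthonormal[of i q i'] by (simp add: tree_def)
qed

text \<open>The coefficients with respect to the orthonormal basis of characters, whence the conjugate.\<close>

definition fourier_transform :: "nat \<Rightarrow> (nat list \<Rightarrow> complex) \<Rightarrow> (nat list \<Rightarrow> complex)" where
  "fourier_transform q = level_transform (tree q) length (\<lambda>k v. cnj (character q k v))"

lemma fourier_transform_unitary: "ell2_unitary (tree q) (tree q) (fourier_transform q)"
  unfolding fourier_transform_def
proof (rule level_transform_unitary[OF finite_tree_level])
  fix k k' assume "k \<in> tree q" "k' \<in> tree q" "length k = length k'"
  then show "(\<Sum>a | a \<in> tree q \<and> length a = length k. cnj (character q k a) * cnj (cnj (character q k' a)))
        = (if k = k' then 1 else 0)"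
    and "(\<Sum>b | b \<in> tree q \<and> length b = length k. cnj (character q b k) * cnj (cnj (character q b k')))
        = (if k = k' then 1 else 0)"
    using character_orthonormal[of k' q k] character_sym[of q _ k] character_sym[of q _ k']
    by (simp_all add: mult.commute eq_commute)
qed

lemma fourier_transform_delta:
  assumes "v \<in> tree q"
  shows "fourier_transform q (ell2_delta v) k =
    (if k \<in> tree q \<and> length k = length v then cnj (character q k v) else 0)"
proof -
  have "(\<Sum>a | a \<in> tree q \<and> length a = length k. cnj (character q k a) * ell2_delta v a)
     = (\<Sum>a | a \<in> tree q \<and> length a = length k. if a = v then cnj (character q k a) else 0)"
    by (intro sum.cong) (auto simp: ell2_delta_def)
  then show ?thesis
    using assms finite_tree_level[of q "length k"]
    by (auto simp: fourier_transform_def level_transform_def)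
qed

section \<open>Words up to trailing zeros\<close>

text \<open>Stems label the orbits of the map \<open>k \<mapsto> k @ [0]\<close>, by which the shift to the children acts on
  frequencies.\<close>

definition stem :: "nat list \<Rightarrow> nat list" where
  "stem k = rev (dropWhile (\<lambda>i. i = 0) (rev k))"

lemma stem_append_zeros [simp]: "stem (k @ replicate n 0) = stem k"
proof -
  have "dropWhile (\<lambda>i. i = 0) (replicate n (0::nat) @ xs) = dropWhile (\<lambda>i. i = 0) xs" for xs
    by (induction n) auto
  then show ?thesis by (simp add: stem_def)
qed

lemma stem_decomp: "k = stem k @ replicate (length k - length (stem k)) 0"
proof -
  let ?z = "takeWhile (\<lambda>i. i = 0) (rev k)"
  have "k = stem k @ rev ?z"
    unfolding stem_def by (metis rev_append rev_rev_ident takeWhile_dropWhile_id)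
  moreover have "rev ?z = replicate (length ?z) 0"
    by (auto intro!: replicate_eqI dest: set_takeWhileD)
  ultimately have e: "k = stem k @ replicate (length ?z) 0" by metis
  then have "length k = length (stem k) + length ?z" by (metis length_append length_replicate)
  with e show ?thesis by simp
qed

lemma stem_length_le: "length (stem k) \<le> length k"
  by (metis length_append le_add1 stem_decomp)

lemma stem_stem [simp]: "stem (stem k) = stem k"
  by (metis stem_append_zeros stem_decomp)

lemma stem_in_tree: "k \<in> tree q \<Longrightarrow> stem k \<in> tree q"
  by (auto simp: stem_def tree_def in_lists_conv_set dest: set_dropWhileD)

lemma append_zeros_in_tree: "s \<in> tree q \<Longrightarrow> q > 0 \<Longrightarrow> s @ replicate n 0 \<in> tree q"
  by (auto simp: tree_def in_lists_conv_set)

lemma stem_eq_iff: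
  assumes "length k' \<le> length k"
  shows "stem k = stem k' \<longleftrightarrow> k = k' @ replicate (length k - length k') 0"
proof
  assume e: "stem k = stem k'"
  have "k = stem k' @ replicate (length k - length (stem k')) 0"
    using stem_decomp[of k] e by simp
  also have "length k - length (stem k') = (length k' - length (stem k')) + (length k - length k')"
    using assms stem_length_le[of k'] by simp
  also have "stem k' @ replicate \<dots> 0 = k' @ replicate (length k - length k') 0"
    by (simp only: replicate_add append.assoc[symmetric] stem_decomp[symmetric])
  finally show "k = k' @ replicate (length k - length k') 0" .
next
  assume "k = k' @ replicate (length k - length k') 0"
  then show "stem k = stem k'" by (metis stem_append_zeros)
qed

definition stems :: "nat \<Rightarrow> nat list set" where
  "stems q = {k \<in> tree q. stem k = k}"

lemma stems_infinite:
  assumes "q \<ge> 2" shows "infinite (stems q)"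
proof -
  have "replicate n 1 \<in> stems q" for n
  proof -
    have "stem (replicate n 1) = replicate n 1"
      by (cases "n = 0") (simp_all add: stem_def dropWhile_eq_self_iff)
    then show ?thesis using assms by (auto simp: stems_def tree_def in_lists_conv_set)
  qed
  moreover have "inj (\<lambda>n. replicate n (1::nat))" by (auto simp: inj_def)
  ultimately show ?thesis
    using infinite_super[of "range (\<lambda>n. replicate n (1::nat))" "stems q"] finite_imageD
    by (metis image_subsetI infinite_UNIV_nat)
qed

text \<open>A word is determined by its stem and its number of trailing zeros.  Any bijection \<open>\<sigma>\<close> between the two
  countably infinite sets of stems thus extends to words by keeping the number of zeros.  The
  extension need not preserve levels, but it does preserve the level differences of words with the
  same stem, and the Toeplitz entries depend on nothing else.\<close>

lemma stem_preserving_bijection: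
  assumes "p \<ge> 2" "q \<ge> 2"
  obtains \<pi> where "bij_betw \<pi> (tree p) (tree q)"
    and "\<And>k k'. k \<in> tree p \<Longrightarrow> k' \<in> tree p \<Longrightarrow> stem (\<pi> k) = stem (\<pi> k') \<longleftrightarrow> stem k = stem k'"
    and "\<And>k. k \<in> tree p \<Longrightarrow> length (\<pi> k) - length (stem (\<pi> k)) = length k - length (stem k)"
proof -
  have "bij_betw (from_nat_into (stems r)) UNIV (stems r)" if "r \<ge> 2" for r
    by (rule bij_betw_from_nat_into) (use stems_infinite[OF that] in auto)
  then obtain \<sigma> where \<sigma>: "bij_betw \<sigma> (stems p) (stems q)"
    by (metis assms bij_betw_inv_into bij_betw_trans)
  define \<tau> where "\<tau> = inv_into (stems p) \<sigma>"
  have \<tau>: "bij_betw \<tau> (stems q) (stems p)" unfolding \<tau>_def by (rule bij_betw_inv_into[OF \<sigma>])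
  \<comment> \<open>Applied to \<open>\<sigma>\<close> and to its inverse \<open>\<tau>\<close>, this gives mutually inverse maps.\<close>
  define ext where "ext \<rho> k = \<rho> (stem k) @ replicate (length k - length (stem k)) 0" for \<rho> :: "nat list \<Rightarrow> nat list" and k
  have mem: "stem k \<in> stems r" if "k \<in> tree r" for k r
    using that by (simp add: stems_def stem_in_tree)
  have ext: "ext \<rho> k \<in> tree r'" "stem (ext \<rho> k) = \<rho> (stem k)"
     "length (ext \<rho> k) - length (stem (ext \<rho> k)) = length k - length (stem k)"
    if "bij_betw \<rho> (stems r) (stems r')" "k \<in> tree r" "r' \<ge> 2" for \<rho> r r' k
  proof -
    have "\<rho> (stem k) \<in> stems r'" using that mem by (auto simp: bij_betw_def)
    then show "ext \<rho> k \<in> tree r'" "stem (ext \<rho> k) = \<rho> (stem k)"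
      using that by (auto simp: ext_def stems_def append_zeros_in_tree)
    then show "length (ext \<rho> k) - length (stem (ext \<rho> k)) = length k - length (stem k)"
      by (simp add: ext_def)
  qed
  have inv: "ext \<rho>' (ext \<rho> k) = k"
    if "bij_betw \<rho> (stems r) (stems r')" "k \<in> tree r" "r' \<ge> 2" "\<rho>' (\<rho> (stem k)) = stem k" for \<rho> \<rho>' r r' k
    using ext[OF that(1-3)] that(4) stem_decomp[of k] unfolding ext_def[of \<rho>'] by simp
  show ?thesis
  proof (rule that[of "ext \<sigma>"])
    show "bij_betw (ext \<sigma>) (tree p) (tree q)"
    proof (rule bij_betw_byWitness[where f' = "ext \<tau>"])
      show "\<forall>k\<in>tree p. ext \<tau> (ext \<sigma> k) = k"
        using inv[OF \<sigma>] assms mem bij_betw_inv_into_left[OF \<sigma>] by (auto simp: \<tau>_def)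
      show "\<forall>k\<in>tree q. ext \<sigma> (ext \<tau> k) = k"
        using inv[OF \<tau>] assms mem bij_betw_inv_into_right[OF \<sigma>] by (auto simp: \<tau>_def)
    qed (use ext[OF \<sigma>] ext[OF \<tau>] assms in auto)
    fix k k' assume k: "k \<in> tree p" "k' \<in> tree p"
    show "stem (ext \<sigma> k) = stem (ext \<sigma> k') \<longleftrightarrow> stem k = stem k'"
      using ext(2)[OF \<sigma> k(1)] ext(2)[OF \<sigma> k(2)] assms mem[OF k(1)] mem[OF k(2)] \<sigma>
      by (auto simp: bij_betw_def inj_on_def)
  next
    fix k assume "k \<in> tree p"
    then show "length (ext \<sigma> k) - length (stem (ext \<sigma> k)) = length k - length (stem k)"
      using ext(3)[OF \<sigma>] assms by blast
  qed
qed

section \<open>Direct sums of Toeplitz matrices are bounded\<close>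

definition circle_measure :: "real measure" where
  "circle_measure = restrict_space lebesgue {0..2 * pi}"

lemma finite_circle_measure: "finite_measure circle_measure"
  by (rule finite_measureI) (simp add: circle_measure_def emeasure_restrict_space space_restrict_space)

lemma borel_measurable_circle_measure:
  "g \<in> borel_measurable lebesgue \<Longrightarrow> g \<in> borel_measurable circle_measure"
  by (simp add: circle_measure_def measurable_restrict_space1)

lemma borel_measurable_circle_continuous:
  fixes g :: "real \<Rightarrow> 'a::{second_countable_topology,real_normed_vector}"
  assumes "continuous_on UNIV g"
  shows "g \<in> borel_measurable circle_measure"
  using borel_measurable_continuous_onI[OF assms]
  by (intro borel_measurable_circle_measure measurable_completion) simp

lemma set_integral_circle_measure:
  fixes g :: "real \<Rightarrow> complex"
  shows "(LINT \<theta>:{0..2 * pi}|lebesgue. g \<theta>) = (\<integral>\<theta>. g \<theta> \<partial>circle_measure)"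
  unfolding circle_measure_def set_lebesgue_integral_def by (subst integral_restrict_space) simp_all

lemma integral_circle_cis:
  "(\<integral>\<theta>. cis (of_int n * \<theta>) \<partial>circle_measure) = (if n = 0 then 2 * pi else 0)"
proof -
  have "continuous_on {0..2 * pi} (\<lambda>\<theta>. cis (of_int n * \<theta>))"
    by (intro continuous_intros)
  then have "(\<integral>\<theta>. cis (of_int n * \<theta>) \<partial>circle_measure) = integral {0..2 * pi} (\<lambda>\<theta>. cis (of_int n * \<theta>))"
    using set_lebesgue_integral_eq_integral(2)[OF absolutely_integrable_continuous_real]
      set_integral_circle_measure by metis
  also have "\<dots> = (if n = 0 then 2 * pi else 0)"
  proof (cases "n = 0")
    case False
    define F where "F \<theta> = cis (of_int n * \<theta>) / (\<i> * of_int n)" for \<theta>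
    have "((\<lambda>\<theta>. cis (of_int n * \<theta>)) has_integral (F (2 * pi) - F 0)) {0..2 * pi}"
    proof (rule fundamental_theorem_of_calculus)
      fix \<theta>
      have "((\<lambda>\<theta>. exp (\<i> * of_int n * of_real \<theta>) / (\<i> * of_int n)) has_vector_derivative
          exp (\<i> * of_int n * of_real \<theta>)) (at \<theta> within {0..2 * pi})"
        using False by (auto intro!: derivative_eq_intros has_vector_derivative_real_field)
      then show "(F has_vector_derivative cis (of_int n * \<theta>)) (at \<theta> within {0..2 * pi})"
        by (simp add: F_def[abs_def] cis_conv_exp mult.assoc)
    qed simp
    moreover have "F (2 * pi) = F 0"
      using cis_multiple_2pi[of "of_int n"] by (simp add: F_def mult_ac)
    ultimately show ?thesis using False by (simp add: integral_unique)
  qed (simp add: scaleR_conv_of_real)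
  finally show ?thesis .
qed

lemma integrable_circle_bounded:
  fixes g :: "real \<Rightarrow> 'a::{banach,second_countable_topology}"
  assumes "g \<in> borel_measurable circle_measure" "AE \<theta> in circle_measure. norm (g \<theta>) \<le> B"
  shows "integrable circle_measure g"
  using finite_measure.integrable_const_bound[OF finite_circle_measure assms(2,1)] .

definition trig_poly :: "('a \<Rightarrow> int) \<Rightarrow> 'a set \<Rightarrow> ('a \<Rightarrow> complex) \<Rightarrow> real \<Rightarrow> complex" where
  "trig_poly l F x \<theta> = (\<Sum>a\<in>F. x a * cis (of_int (l a) * \<theta>))"

lemma trig_poly_measurable: "trig_poly l F x \<in> borel_measurable circle_measure"
  unfolding trig_poly_def by (intro borel_measurable_circle_continuous continuous_intros)

lemma trig_poly_bound: "norm (trig_poly l F x \<theta>) \<le> (\<Sum>a\<in>F. norm (x a))"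
  unfolding trig_poly_def by (rule order_trans[OF norm_sum]) (simp add: norm_mult)

lemma trig_poly_square_integrable: "integrable circle_measure (\<lambda>\<theta>. (norm (trig_poly l F x \<theta>))\<^sup>2)"
proof (rule integrable_circle_bounded[where B = "(\<Sum>a\<in>F. norm (x a))\<^sup>2"])
  show "(\<lambda>\<theta>. (norm (trig_poly l F x \<theta>))\<^sup>2) \<in> borel_measurable circle_measure"
    using trig_poly_measurable by measurable
  show "AE \<theta> in circle_measure. norm ((norm (trig_poly l F x \<theta>))\<^sup>2) \<le> (\<Sum>a\<in>F. norm (x a))\<^sup>2"
    by (intro AE_I2) (simp add: power_mono trig_poly_bound)
qed

lemma trig_poly_product:
  "trig_poly l G x \<theta> * cnj (trig_poly l F y \<theta>) =
     (\<Sum>a\<in>F. \<Sum>b\<in>G. x b * cnj (y a) * cis (- (of_int (l a - l b) * \<theta>)))"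
proof -
  have "trig_poly l G x \<theta> * cnj (trig_poly l F y \<theta>) =
      (\<Sum>b\<in>G. \<Sum>a\<in>F. (x b * cis (of_int (l b) * \<theta>)) * cnj (y a * cis (of_int (l a) * \<theta>)))"
    by (simp add: trig_poly_def sum_product)
  also have "\<dots> = (\<Sum>b\<in>G. \<Sum>a\<in>F. x b * cnj (y a) * cis (- (of_int (l a - l b) * \<theta>)))"
  proof (intro sum.cong refl)
    fix a b
    have "cis (- (of_int (l a - l b) * \<theta>)) = cis (of_int (l b) * \<theta>) * cnj (cis (of_int (l a) * \<theta>))"
      by (simp add: cis_cnj cis_mult algebra_simps)
    then show "(x b * cis (of_int (l b) * \<theta>)) * cnj (y a * cis (of_int (l a) * \<theta>))
        = x b * cnj (y a) * cis (- (of_int (l a - l b) * \<theta>))"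
      by simp
  qed
  finally show ?thesis by (simp add: sum.swap[of _ F G])
qed

text \<open>Injectivity of \<open>l\<close> on \<open>F\<close> says that the frequencies are distinct, so the exponentials are
  orthogonal.\<close>

lemma trig_poly_parseval:
  assumes "finite F" "inj_on l F"
  shows "(\<integral>\<theta>. (norm (trig_poly l F x \<theta>))\<^sup>2 \<partial>circle_measure) = 2 * pi * (\<Sum>a\<in>F. (norm (x a))\<^sup>2)"
proof -
  have int: "integrable circle_measure (\<lambda>\<theta>. cis (- (of_int n * \<theta>)))" for n
    by (rule integrable_circle_bounded[where B = 1])
       (auto intro!: borel_measurable_circle_continuous continuous_intros)
  have val: "(\<integral>\<theta>. cis (- (of_int n * \<theta>)) \<partial>circle_measure) = (if n = 0 then 2 * pi else 0)" for n
    using integral_circle_cis[of "- n"] by simp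
  have "complex_of_real (\<integral>\<theta>. (norm (trig_poly l F x \<theta>))\<^sup>2 \<partial>circle_measure)
      = (\<integral>\<theta>. complex_of_real ((norm (trig_poly l F x \<theta>))\<^sup>2) \<partial>circle_measure)"
    by (rule integral_complex_of_real[symmetric])
  also have "\<dots> = (\<integral>\<theta>. (\<Sum>a\<in>F. \<Sum>b\<in>F. x b * cnj (x a) * cis (- (of_int (l a - l b) * \<theta>))) \<partial>circle_measure)"
    by (simp only: complex_norm_square trig_poly_product)
  also have "\<dots> = (\<Sum>a\<in>F. \<Sum>b\<in>F. x b * cnj (x a) * (\<integral>\<theta>. cis (- (of_int (l a - l b) * \<theta>)) \<partial>circle_measure))"
    using int by (simp del: of_int_diff)
  also have "\<dots> = (\<Sum>a\<in>F. \<Sum>b\<in>F. if a = b then 2 * pi * (x a * cnj (x a)) else 0)"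
    using assms(2) by (intro sum.cong refl) (auto simp: val inj_on_eq_iff simp del: of_int_diff)
  also have "\<dots> = of_real (2 * pi * (\<Sum>a\<in>F. (norm (x a))\<^sup>2))"
    using assms(1) by (simp add: sum_distrib_left complex_norm_square del: of_real_power)
  finally show ?thesis by (simp only: of_real_eq_iff)
qed

text \<open>With \<open>y\<close> the image of \<open>x\<close> under the submatrix, \<open>\<parallel>y\<parallel>\<^sup>2\<close> is the mean of \<open>f X cnj Y\<close> over the circle, where
  \<open>X\<close> and \<open>Y\<close> are the trigonometric polynomials with coefficients \<open>x\<close> and \<open>y\<close>.  The pointwise bound
  \<open>\<bar>f X Y\<bar> \<le> (M\<^sup>2 \<bar>X\<bar>\<^sup>2 + \<bar>Y\<bar>\<^sup>2) / 2\<close> and Parseval give \<open>\<parallel>y\<parallel>\<^sup>2 \<le> (M\<^sup>2 \<parallel>x\<parallel>\<^sup>2 + \<parallel>y\<parallel>\<^sup>2) / 2\<close>, where the last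
  term can be absorbed on the left.\<close>

lemma toeplitz_finite_bound:
  assumes f: "(\<lambda>\<theta>. f (cis \<theta>)) \<in> borel_measurable lebesgue" "AE \<theta> in lebesgue. norm (f (cis \<theta>)) \<le> M"
    and F: "finite F" "inj_on l F" and G: "finite G" "inj_on l G"
  shows "(\<Sum>a\<in>F. (norm (\<Sum>b\<in>G. fourier_coeff f (l a - l b) * x b))\<^sup>2) \<le> M\<^sup>2 * (\<Sum>b\<in>G. (norm (x b))\<^sup>2)"
proof -
  define y where "y a = (\<Sum>b\<in>G. fourier_coeff f (l a - l b) * x b)" for a
  let ?X = "trig_poly l G x" and ?Y = "trig_poly l F y"
  have meas: "(\<lambda>\<theta>. f (cis \<theta>)) \<in> borel_measurable circle_measure"
    by (rule borel_measurable_circle_measure[OF f(1)])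
  have bnd: "AE \<theta> in circle_measure. norm (f (cis \<theta>)) \<le> M"
    unfolding circle_measure_def
    by (subst AE_restrict_space_iff) (use f(2) in \<open>auto elim: eventually_mono\<close>)
  have int: "integrable circle_measure (\<lambda>\<theta>. f (cis \<theta>) * cis (- (of_int n * \<theta>)))" for n
  proof (rule integrable_circle_bounded[where B = M])
    have "(\<lambda>\<theta>. cis (- (of_int n * \<theta>))) \<in> borel_measurable circle_measure"
      by (intro borel_measurable_circle_continuous continuous_intros)
    with meas show "(\<lambda>\<theta>. f (cis \<theta>) * cis (- (of_int n * \<theta>))) \<in> borel_measurable circle_measure"
      by (rule borel_measurable_times)
  qed (use bnd in \<open>simp add: norm_mult\<close>)
  have coeff: "(\<integral>\<theta>. f (cis \<theta>) * cis (- (of_int n * \<theta>)) \<partial>circle_measure) = 2 * pi * fourier_coeff f n" for n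
    by (simp add: fourier_coeff_def set_integral_circle_measure)
  have expand: "f (cis \<theta>) * (?X \<theta> * cnj (?Y \<theta>))
      = (\<Sum>a\<in>F. \<Sum>b\<in>G. x b * cnj (y a) * (f (cis \<theta>) * cis (- (of_int (l a - l b) * \<theta>))))" for \<theta>
    by (simp add: trig_poly_product sum_distrib_left mult.left_commute del: of_int_diff)
  have intXY: "integrable circle_measure (\<lambda>\<theta>. f (cis \<theta>) * (?X \<theta> * cnj (?Y \<theta>)))"
    unfolding expand by (intro Bochner_Integration.integrable_sum integrable_mult_right int)
  have "(\<integral>\<theta>. f (cis \<theta>) * (?X \<theta> * cnj (?Y \<theta>)) \<partial>circle_measure)
      = (\<Sum>a\<in>F. \<Sum>b\<in>G. x b * cnj (y a) * (2 * pi * fourier_coeff f (l a - l b)))"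
    unfolding expand using int by (simp add: coeff del: of_int_diff)
  also have "\<dots> = 2 * pi * (\<Sum>a\<in>F. y a * cnj (y a))"
  proof -
    have "(\<Sum>b\<in>G. x b * cnj (y a) * (2 * pi * fourier_coeff f (l a - l b))) = 2 * pi * (y a * cnj (y a))" for a
    proof -
      have "(\<Sum>b\<in>G. x b * cnj (y a) * (2 * pi * fourier_coeff f (l a - l b)))
          = 2 * pi * ((\<Sum>b\<in>G. fourier_coeff f (l a - l b) * x b) * cnj (y a))"
        by (simp add: sum_distrib_left sum_distrib_right mult_ac)
      then show ?thesis by (simp only: y_def[symmetric])
    qed
    then show ?thesis by (simp only: sum_distrib_left)
  qed
  also have "\<dots> = of_real (2 * pi * (\<Sum>a\<in>F. (norm (y a))\<^sup>2))"
    by (simp only: complex_norm_square of_real_mult of_real_sum of_real_numeral)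
  finally have "2 * pi * (\<Sum>a\<in>F. (norm (y a))\<^sup>2)
      = norm (\<integral>\<theta>. f (cis \<theta>) * (?X \<theta> * cnj (?Y \<theta>)) \<partial>circle_measure)"
    by (simp only: norm_of_real) (simp add: sum_nonneg)
  also have "\<dots> \<le> (\<integral>\<theta>. norm (f (cis \<theta>) * (?X \<theta> * cnj (?Y \<theta>))) \<partial>circle_measure)"
    by (rule integral_norm_bound)
  also have "\<dots> \<le> (\<integral>\<theta>. M\<^sup>2 / 2 * (norm (?X \<theta>))\<^sup>2 + 1 / 2 * (norm (?Y \<theta>))\<^sup>2 \<partial>circle_measure)"
  proof (rule integral_mono_AE)
    show "integrable circle_measure (\<lambda>\<theta>. M\<^sup>2 / 2 * (norm (?X \<theta>))\<^sup>2 + 1 / 2 * (norm (?Y \<theta>))\<^sup>2)"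
      by (intro Bochner_Integration.integrable_add integrable_mult_right trig_poly_square_integrable)
    have "norm (f (cis \<theta>) * (?X \<theta> * cnj (?Y \<theta>))) \<le> M\<^sup>2 / 2 * (norm (?X \<theta>))\<^sup>2 + 1 / 2 * (norm (?Y \<theta>))\<^sup>2"
      if "norm (f (cis \<theta>)) \<le> M" for \<theta>
    proof -
      have "norm (f (cis \<theta>) * (?X \<theta> * cnj (?Y \<theta>))) \<le> M * norm (?X \<theta>) * norm (?Y \<theta>)"
        using that by (simp add: norm_mult mult.assoc mult_right_mono)
      moreover have "2 * (M * norm (?X \<theta>)) * norm (?Y \<theta>) \<le> (M * norm (?X \<theta>))\<^sup>2 + (norm (?Y \<theta>))\<^sup>2"
        by (rule sum_squares_bound)
      ultimately show ?thesis by (simp add: power_mult_distrib)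
    qed
    then show "AE \<theta> in circle_measure. norm (f (cis \<theta>) * (?X \<theta> * cnj (?Y \<theta>)))
        \<le> M\<^sup>2 / 2 * (norm (?X \<theta>))\<^sup>2 + 1 / 2 * (norm (?Y \<theta>))\<^sup>2"
      using bnd by (auto elim: eventually_mono)
  qed (rule integrable_norm[OF intXY])
  also have "\<dots> = M\<^sup>2 / 2 * (2 * pi * (\<Sum>b\<in>G. (norm (x b))\<^sup>2)) + 1 / 2 * (2 * pi * (\<Sum>a\<in>F. (norm (y a))\<^sup>2))"
    by (subst Bochner_Integration.integral_add)
       (simp_all only: integral_mult_right_zero trig_poly_parseval[OF F] trig_poly_parseval[OF G]
         integrable_mult_right trig_poly_square_integrable)
  also have "\<dots> = 2 * pi * (M\<^sup>2 / 2 * (\<Sum>b\<in>G. (norm (x b))\<^sup>2) + (\<Sum>a\<in>F. (norm (y a))\<^sup>2) / 2)"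
    by (simp add: algebra_simps)
  finally have "(\<Sum>a\<in>F. (norm (y a))\<^sup>2) \<le> M\<^sup>2 / 2 * (\<Sum>b\<in>G. (norm (x b))\<^sup>2) + (\<Sum>a\<in>F. (norm (y a))\<^sup>2) / 2"
    by (rule mult_left_le_imp_le) simp
  then show ?thesis unfolding y_def by (simp add: field_simps)
qed

text \<open>A direct sum of Toeplitz matrices, or submatrices of such: \<open>c\<close> names the summand to which an index
  belongs and \<open>l\<close> its position there.\<close>

definition toeplitz_sum :: "(complex \<Rightarrow> complex) \<Rightarrow> ('a \<Rightarrow> 'c) \<Rightarrow> ('a \<Rightarrow> int) \<Rightarrow> 'a \<Rightarrow> 'a \<Rightarrow> complex" where
  "toeplitz_sum f c l a b = (if c a = c b then fourier_coeff f (l a - l b) else 0)"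

text \<open>The summands do not interact, so the bound for a single Toeplitz matrix is added up over the
  classes of \<open>c\<close>.\<close>

lemma toeplitz_sum_bounded:
  assumes f: "f \<in> Linf_circle" and inj: "inj_on (\<lambda>a. (c a, l a)) V"
  shows "ell2_bounded_operator V (kernel_operator V (toeplitz_sum f c l))"
proof -
  obtain B where B: "(\<lambda>\<theta>. f (cis \<theta>)) \<in> borel_measurable lebesgue" "AE \<theta> in lebesgue. norm (f (cis \<theta>)) \<le> B"
    using f by (auto simp: Linf_circle_def)
  define M where "M = \<bar>B\<bar>"
  have M: "AE \<theta> in lebesgue. norm (f (cis \<theta>)) \<le> M" "M \<ge> 0"
    using B(2) by (auto simp: M_def elim!: eventually_mono)
  show ?thesis
  proof (rule kernel_operator_bounded[OF M(2)])
    fix F G :: "'a set" and x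
    assume F: "finite F" "F \<subseteq> V" and G: "finite G" "G \<subseteq> V"
    let ?F = "\<lambda>i. {a \<in> F. c a = i}" and ?G = "\<lambda>i. {b \<in> G. c b = i}"
    define I where "I = c ` (F \<union> G)"
    have I: "finite I" "c ` F \<subseteq> I" "c ` G \<subseteq> I" using F G by (auto simp: I_def)
    have injl: "inj_on l {a \<in> A. c a = i}" if "A \<subseteq> V" for A i
    proof (rule inj_onI)
      fix a b assume "a \<in> {a \<in> A. c a = i}" "b \<in> {a \<in> A. c a = i}" "l a = l b"
      then show "a = b" using inj_onD[OF inj, of a b] that by auto
    qed
    have row: "(\<Sum>b\<in>G. toeplitz_sum f c l a b * x b) = (\<Sum>b\<in>?G i. fourier_coeff f (l a - l b) * x b)"
      if "c a = i" for a i
      using G that by (intro sum.mono_neutral_cong_right) (auto simp: toeplitz_sum_def)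
    have "(\<Sum>a\<in>F. (norm (\<Sum>b\<in>G. toeplitz_sum f c l a b * x b))\<^sup>2)
        = (\<Sum>i\<in>I. \<Sum>a\<in>?F i. (norm (\<Sum>b\<in>G. toeplitz_sum f c l a b * x b))\<^sup>2)"
      by (rule sum.group[symmetric]) (use F I in auto)
    also have "\<dots> = (\<Sum>i\<in>I. \<Sum>a\<in>?F i. (norm (\<Sum>b\<in>?G i. fourier_coeff f (l a - l b) * x b))\<^sup>2)"
      by (intro sum.cong refl) (simp add: row)
    also have "\<dots> \<le> (\<Sum>i\<in>I. M\<^sup>2 * (\<Sum>b\<in>?G i. (norm (x b))\<^sup>2))"
      using F G by (intro sum_mono toeplitz_finite_bound[OF B(1) M(1)] injl) auto
    also have "\<dots> = M\<^sup>2 * (\<Sum>i\<in>I. \<Sum>b\<in>?G i. (norm (x b))\<^sup>2)"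
      by (simp add: sum_distrib_left)
    also have "(\<Sum>i\<in>I. \<Sum>b\<in>?G i. (norm (x b))\<^sup>2) = (\<Sum>b\<in>G. (norm (x b))\<^sup>2)"
      by (rule sum.group) (use G I in auto)
    finally show "(\<Sum>a\<in>F. (norm (\<Sum>b\<in>G. toeplitz_sum f c l a b * x b))\<^sup>2) \<le> M\<^sup>2 * (\<Sum>b\<in>G. (norm (x b))\<^sup>2)" .
  qed
qed

section \<open>The operators of the tree as direct sums of Toeplitz matrices\<close>

lemma inj_on_stem_length: "inj_on (\<lambda>k. (stem k, int (length k))) A"
proof (rule inj_onI)
  fix k k' assume "(stem k, int (length k)) = (stem k', int (length k'))"
  then show "k = k'" using stem_decomp[of k] stem_decomp[of k'] by simp
qed

definition tree_toeplitz :: "(complex \<Rightarrow> complex) \<Rightarrow> nat list \<Rightarrow> nat list \<Rightarrow> complex" where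
  "tree_toeplitz f = toeplitz_sum f stem (\<lambda>k. int (length k))"

lemma tree_toeplitz_bounded:
  "f \<in> Linf_circle \<Longrightarrow> ell2_bounded_operator (tree q) (kernel_operator (tree q) (tree_toeplitz f))"
  unfolding tree_toeplitz_def by (rule toeplitz_sum_bounded[OF _ inj_on_stem_length])

text \<open>On level \<open>length v\<close> the only frequency with the same stem as \<open>k'\<close> is \<open>k'\<close> followed by zeros.  The value
  of its character at \<open>v\<close> is that of \<open>k'\<close> at the ancestor \<open>u\<close> of \<open>v\<close> on the level of \<open>w\<close>, times a
  normalization, and the remaining sum over \<open>k'\<close> tests whether \<open>u = w\<close>.\<close>

lemma character_stem_sum:
  assumes v: "v \<in> tree q" and w: "w \<in> tree q" and q: "q > 0" and le: "length w \<le> length v"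
  shows "(\<Sum>k | k \<in> tree q \<and> length k = length v. \<Sum>k' | k' \<in> tree q \<and> length k' = length w.
      if stem k = stem k' then character q k v * cnj (character q k' w) else 0)
    = (if prefix w v then of_real (q powr (- real (length v - length w) / 2)) else 0)"
proof -
  define n where "n = length v - length w"
  define u where "u = take (length w) v"
  define s where "s = (1 / complex_of_real (sqrt (real q))) ^ n"
  let ?L = "\<lambda>m. {k \<in> tree q. length k = m}"
  have u: "u \<in> tree q" "length u = length w"
    using v le by (auto simp: u_def tree_def in_lists_conv_set dest: in_set_takeD)
  have inner: "(\<Sum>k\<in>?L (length v). if stem k = stem k' then character q k v * cnj (character q k' w) else 0)
      = s * (character q k' u * cnj (character q k' w))" if k': "k' \<in> ?L (length w)" for k'
  proof -
    have "(\<Sum>k\<in>?L (length v). if stem k = stem k' then character q k v * cnj (character q k' w) else 0)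
        = (\<Sum>k\<in>?L (length v). if k = k' @ replicate n 0 then character q k v * cnj (character q k' w) else 0)"
      using k' le by (intro sum.cong refl) (auto simp: stem_eq_iff n_def)
    also have "\<dots> = character q (k' @ replicate n 0) v * cnj (character q k' w)"
      using k' le q finite_tree_level[of q "length v"]
      by (simp add: append_zeros_in_tree n_def)
    also have "character q (k' @ replicate n 0) v = character q k' u * s"
    proof -
      have "character q (k' @ replicate n 0) (u @ drop (length w) v) = character q k' u * s"
        using character_append[of k' u q "replicate n 0" "drop (length w) v"]
          character_zeros[of q "drop (length w) v"] k' u by (simp add: n_def s_def)
      then show ?thesis by (simp add: u_def)
    qed
    finally show ?thesis by (simp add: mult_ac)
  qed
  have "(\<Sum>k\<in>?L (length v). \<Sum>k'\<in>?L (length w).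
      if stem k = stem k' then character q k v * cnj (character q k' w) else 0)
    = (\<Sum>k'\<in>?L (length w). s * (character q k' u * cnj (character q k' w)))"
    by (subst sum.swap) (simp add: inner)
  also have "\<dots> = s * (\<Sum>k'\<in>?L (length w). character q u k' * cnj (character q w k'))"
    by (simp only: sum_distrib_left character_sym[of q u] character_sym[of q w])
  also have "\<dots> = s * (if u = w then 1 else 0)"
    using character_orthonormal[OF u(1) w u(2)] by (simp only: u(2))
  also have "u = w \<longleftrightarrow> prefix w v"
    by (metis append_eq_conv_conj append_take_drop_id prefixE prefixI u_def)
  also have "s = of_real (q powr (- real n / 2))"
  proof -
    have "q powr (- real n / 2) = (q powr (- 1 / 2)) powr real n"
      by (simp add: powr_powr)
    also have "\<dots> = (1 / sqrt q) ^ n"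
      using q by (simp add: powr_realpow powr_minus_divide powr_half_sqrt)
    finally show ?thesis by (simp add: s_def)
  qed
  finally show ?thesis by (simp add: n_def)
qed

text \<open>On fixed levels the Toeplitz entries are a constant times the indicator of equal stems, so only
  the sum of \<open>character_stem_sum\<close> remains.  That sum is Hermitian in \<open>(v, w)\<close>, so it suffices
  to know it when \<open>v\<close> is on the deeper of the two levels.\<close>

lemma Gamma_kernel_fourier:
  assumes v: "v \<in> tree q" and w: "w \<in> tree q" and q: "q > 0"
  shows "ell2_inner (tree q)
      (kernel_operator (tree q) (tree_toeplitz f) (fourier_transform q (ell2_delta w)))
      (fourier_transform q (ell2_delta v)) = Gamma_kernel q f v w"
proof -
  let ?L = "\<lambda>m. {k \<in> tree q. length k = m}"
  define c where "c = fourier_coeff f (int (length v) - int (length w))"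
  define S where "S v w = (\<Sum>k\<in>?L (length v). \<Sum>k'\<in>?L (length w).
      if stem k = stem k' then character q k v * cnj (character q k' w) else 0)" for v w
  have flip: "S v w = cnj (S w v)"
    unfolding S_def by (subst sum.swap) (auto intro!: sum.cong)
  have "ell2_inner (tree q)
      (kernel_operator (tree q) (tree_toeplitz f) (fourier_transform q (ell2_delta w)))
      (fourier_transform q (ell2_delta v))
    = (\<Sum>k\<in>?L (length v). \<Sum>k'\<in>?L (length w).
        tree_toeplitz f k k' * fourier_transform q (ell2_delta w) k'
          * cnj (fourier_transform q (ell2_delta v) k))"
    by (rule ell2_inner_kernel_operator_finite)
       (auto simp: finite_tree_level fourier_transform_delta v w)
  also have "\<dots> = (\<Sum>k\<in>?L (length v). \<Sum>k'\<in>?L (length w).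
      c * (if stem k = stem k' then character q k v * cnj (character q k' w) else 0))"
    by (intro sum.cong refl)
       (auto simp: tree_toeplitz_def toeplitz_sum_def fourier_transform_delta v w c_def)
  also have "\<dots> = c * S v w"
    by (simp only: S_def sum_distrib_left)
  also have "\<dots> = Gamma_kernel q f v w"
  proof (cases "length w \<le> length v")
    case True
    have "S v w = (if prefix w v then of_real (q powr (- real (length v - length w) / 2)) else 0)"
      unfolding S_def by (rule character_stem_sum[OF v w q True])
    moreover have "prefix v w \<Longrightarrow> prefix w v"
      using True prefix_length_le[of v w] by (auto simp: prefix_def)
    moreover have "Gamma_kernel q f v w = c * of_real (q powr (- real (length v - length w) / 2))"
      if "prefix w v"
      using that Gamma_kernel_append(1)[of w _ q f] v q by (auto simp: c_def prefix_def)
    ultimately show ?thesis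
      using Gamma_kernel_incomparable[OF v w q, of f] by auto
  next
    case False
    then have le: "length v \<le> length w" by simp
    have "S w v = (if prefix v w then of_real (q powr (- real (length w - length v) / 2)) else 0)"
      unfolding S_def by (rule character_stem_sum[OF w v q le])
    moreover have "prefix w v \<Longrightarrow> prefix v w"
      using False prefix_length_le[of w v] by auto
    moreover have "Gamma_kernel q f v w = c * of_real (q powr (- real (length w - length v) / 2))"
      if "prefix v w"
      using that Gamma_kernel_append(2)[of v _ q f] w q by (auto simp: c_def prefix_def)
    ultimately show ?thesis
      using Gamma_kernel_incomparable[OF v w q, of f] by (auto simp: flip)
  qed
  finally show ?thesis .
qed

lemma Gamma_operator_equivalent_toeplitz:
  assumes "q > 0" "f \<in> Linf_circle"
  shows "unitarily_equivalent (tree q) (Gamma_operator q f)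
           (tree q) (kernel_operator (tree q) (tree_toeplitz f))"
  unfolding Gamma_operator_def
  by (rule unitarily_equivalent_kernel_operatorI
      [OF fourier_transform_unitary tree_toeplitz_bounded[OF assms(2)]])
     (rule Gamma_kernel_fourier[OF _ _ assms(1)])

lemma tree_toeplitz_equivalent:
  assumes "p \<ge> 2" "q \<ge> 2" "f \<in> Linf_circle"
  shows "unitarily_equivalent (tree q) (kernel_operator (tree q) (tree_toeplitz f))
           (tree p) (kernel_operator (tree p) (tree_toeplitz f))"
proof -
  obtain \<pi> where \<pi>: "bij_betw \<pi> (tree p) (tree q)"
    and st: "\<And>k k'. k \<in> tree p \<Longrightarrow> k' \<in> tree p \<Longrightarrow> stem (\<pi> k) = stem (\<pi> k') \<longleftrightarrow> stem k = stem k'"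
    and len: "\<And>k. k \<in> tree p \<Longrightarrow> length (\<pi> k) - length (stem (\<pi> k)) = length k - length (stem k)"
    by (rule stem_preserving_bijection[OF assms(1,2)]) (rule that)
  have kern: "tree_toeplitz f (\<pi> k) (\<pi> k') = tree_toeplitz f k k'"
    if k: "k \<in> tree p" "k' \<in> tree p" for k k'
  proof (cases "stem k = stem k'")
    case True
    then have "int (length (\<pi> k)) - int (length (\<pi> k')) = int (length k) - int (length k')"
      using st[OF k] len[OF k(1)] len[OF k(2)] stem_length_le[of k] stem_length_le[of k']
        stem_length_le[of "\<pi> k"] stem_length_le[of "\<pi> k'"] by simp
    then show ?thesis using True st[OF k] by (simp add: tree_toeplitz_def toeplitz_sum_def)
  qed (use st[OF k] in \<open>simp add: tree_toeplitz_def toeplitz_sum_def\<close>)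
  let ?U = "\<lambda>x k. if k \<in> tree p then x (\<pi> k) else (0::complex)"
  have delta: "?U (ell2_delta (\<pi> k)) = ell2_delta k" if "k \<in> tree p" for k
    using \<pi> that by (auto simp: ell2_delta_def fun_eq_iff bij_betw_def inj_on_eq_iff)
  show ?thesis
  proof (rule unitarily_equivalent_kernel_operatorI
      [OF ell2_unitary_reindex[OF \<pi>] tree_toeplitz_bounded[OF assms(3)]])
    fix v w assume "v \<in> tree q" "w \<in> tree q"
    then obtain k k' where k: "k \<in> tree p" "k' \<in> tree p" "v = \<pi> k" "w = \<pi> k'"
      using \<pi> by (metis bij_betw_imp_surj_on imageE)
    show "ell2_inner (tree p) (kernel_operator (tree p) (tree_toeplitz f) (?U (ell2_delta w)))
        (?U (ell2_delta v)) = tree_toeplitz f v w"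
      unfolding k(3,4) delta[OF k(1)] delta[OF k(2)] kern[OF k(1,2)]
      by (rule kernel_operator_kernel[OF k(1,2)])
  qed
qed

theorem corollary1p6:
  fixes p q :: nat and f :: "complex \<Rightarrow> complex"
  assumes "p \<ge> 2" and "q \<ge> 2" and "f \<in> Linf_circle"
  shows "unitarily_equivalent (tree q) (Gamma_operator q f) (tree p) (Gamma_operator p f)"
proof -
  have "p > 0" "q > 0" using assms by simp_all
  note Q = Gamma_operator_equivalent_toeplitz[OF \<open>q > 0\<close> assms(3)]
    and P = Gamma_operator_equivalent_toeplitz[OF \<open>p > 0\<close> assms(3)]
  show ?thesis
    by (rule unitarily_equivalent_trans[OF Q unitarily_equivalent_trans
        [OF tree_toeplitz_equivalent[OF assms] unitarily_equivalent_sym[OF P]]])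
qed

end
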